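(* Let $I=[0,1]$ and let $\phi:I\to\mathbb{R}$ satisfy $\phi(0)=\phi(1)=0$ and $|\phi(x)-\phi(y)|\le|x-y|$ for all $x,y\in I$. Let $\theta\in(0,1]$, let $C_\theta(u,v)=uv+\theta\,\phi(u)\phi(v)$ on $I^2$, and let $(X,Y)$ be a random pair with copula $C_\theta$ and with joint density $h$. (i) $X$ and $Y$ are PFD. (ii) $X$ and $Y$ are PQD if and only if either $\phi(u)\ge0$ for all $u\in I$ or $\phi(u)\le 0$ for all $u\in I$. (iii) $X$ and $Y$ are LTD if and only if $\phi(u)/u$ is monotone. (iv) $X$ and $Y$ are RTI if and only if $\phi(u)/(u-1)$ is monotone. (v) $X$ and $Y$ are LCSD if and only if they are LTD. (vi) $X$ and $Y$ are RCSI if and only if they are RTI. (vii) $X$ and $Y$ are SI if and only if $\phi$ is either concave or convex. (viii) $X$ and $Y$ have the TP2 density property if and only if they are SI.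
   Context: Under the stated conditions on $\phi$, $C_\theta$ is an absolutely continuous bivariate copula. The pair $(X,Y)$ with marginal distribution functions $F,G$ has copula $C$ if $P(X\le x,Y\le y)=C(F(x),G(y))$ for all real $x,y$. "Monotone" means nonincreasing or nondecreasing; $\phi(u)/u$ is considered for $u\in(0,1]$ and $\phi(u)/(u-1)$ for $u\in[0,1)$. Dependence concepts: PFD (Positive Function Dependent): $\mathbb{E}[g(X)g(Y)]-\mathbb{E}[g(X)]\,\mathbb{E}[g(Y)]\ge0$ for all integrable real-valued functions $g$, the expectation being relative to the density $h$. PQD (Positively Quadrant Dependent): $P(X\le x,Y\le y)\ge P(X\le x)P(Y\le y)$ for all $(x,y)\in\mathbb{R}^2$. LTD$(Y|X)$ (Left Tail Decreasing): $P(Y\le y\mid X\le x)$ is nonincreasing in $x$ for all $y$. RTI$(Y|X)$ (Right Tail Increasing): $P(Y>y\mid X>x)$ is nondecreasing in $x$ for all $y$. SI$(Y|X)$ (Stochastically Increasing): $P(Y>y\mid X=x)$ is nondecreasing in $x$ for all $y$. The notions with $(X|Y)$ are defined by exchanging the roles of $X$ and $Y$; since $C_\theta$ is symmetric in its arguments, the $(Y|X)$ and $(X|Y)$ versions are not distinguished, and one writes simply LTD, RTI, SI. LCSD (Left Corner Set Decreasing): $P(X\le x,Y\le y\mid X\le x',Y\le y')$ is nonincreasing in $x'$ and $y'$ for all $x,y$. RCSI (Right Corner Set Increasing): $P(X>x,Y>y\mid X>x',Y>y')$ is nondecreasing in $x'$ and $y'$ for all $x,y$. TP2 density property: the joint density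 $h$ is totally positive of order 2, i.e. $h(x_1,y_1)h(x_2,y_2)-h(x_1,y_2)h(x_2,y_1)\ge0$ for all $x_1\le x_2$ and $y_1\le y_2$ (densities being understood up to null sets).
   Formalization: Part (i) is proved for X and Y with the same marginal distribution function; for different marginals it fails, e.g. φ(u)=u(1-u), θ=1, X uniform on [0,1], Y uniform on [2,3], g(t)=t on [0,1], g(t)=2-t on [2,3]. *)

theory Defs
  imports "HOL-Probability.Probability"
begin

definition copula_family :: "(real \<Rightarrow> real) \<Rightarrow> real \<Rightarrow> real \<Rightarrow> real \<Rightarrow> real" where
  "copula_family \<phi> \<theta> u v = u * v + \<theta> * \<phi> u * \<phi> v"

definition has_copula ::
  "'a measure \<Rightarrow> ('a \<Rightarrow> real) \<Rightarrow> ('a \<Rightarrow> real) \<Rightarrow> (real \<Rightarrow> real \<Rightarrow> real) \<Rightarrow> bool" where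
  "has_copula M X Y C \<longleftrightarrow>
     (\<forall>x y. \<P>(\<omega> in M. X \<omega> \<le> x \<and> Y \<omega> \<le> y)
        = C (cdf (distr M borel X) x) (cdf (distr M borel Y) y))"

definition joint_density ::
  "'a measure \<Rightarrow> ('a \<Rightarrow> real) \<Rightarrow> ('a \<Rightarrow> real) \<Rightarrow> (real \<times> real \<Rightarrow> real) \<Rightarrow> bool" where
  "joint_density M X Y h \<longleftrightarrow>
     (\<forall>p. 0 \<le> h p) \<and> distributed M lborel (\<lambda>\<omega>. (X \<omega>, Y \<omega>)) (\<lambda>p. ennreal (h p))"

text \<open>The inequality presupposes that all three expectations exist. As the Bochner integral of a
  non-integrable function is 0, the existence of the first one is asserted explicitly. Since one and the same \<open>g\<close> is applied to
  both variables, the notion is intended for identically distributed \<open>X\<close> and \<open>Y\<close>: with different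
  marginals, \<open>g\<close> could reverse the sign on the range of one of them only.\<close>

definition PFD :: "'a measure \<Rightarrow> ('a \<Rightarrow> real) \<Rightarrow> ('a \<Rightarrow> real) \<Rightarrow> bool" where
  "PFD M X Y \<longleftrightarrow>
     (\<forall>g \<in> borel_measurable borel.
        integrable M (\<lambda>\<omega>. g (X \<omega>)) \<longrightarrow> integrable M (\<lambda>\<omega>. g (Y \<omega>)) \<longrightarrow>
        integrable M (\<lambda>\<omega>. g (X \<omega>) * g (Y \<omega>)) \<and>
        (\<integral>\<omega>. g (X \<omega>) * g (Y \<omega>) \<partial>M) - (\<integral>\<omega>. g (X \<omega>) \<partial>M) * (\<integral>\<omega>. g (Y \<omega>) \<partial>M) \<ge> (0::real))"

definition PQD :: "'a measure \<Rightarrow> ('a \<Rightarrow> real) \<Rightarrow> ('a \<Rightarrow> real) \<Rightarrow> bool" where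
  "PQD M X Y \<longleftrightarrow>
     (\<forall>x y. \<P>(\<omega> in M. X \<omega> \<le> x \<and> Y \<omega> \<le> y) \<ge> \<P>(\<omega> in M. X \<omega> \<le> x) * \<P>(\<omega> in M. Y \<omega> \<le> y))"

text \<open>Conditional probabilities are compared only where the conditioning event has positive
  probability. \<open>LTD\<close>, \<open>RTI\<close> and \<open>SI\<close> below are the \<open>(Y|X)\<close> versions; the \<open>(X|Y)\<close> versions
  are obtained by swapping the two arguments.\<close>

definition LTD :: "'a measure \<Rightarrow> ('a \<Rightarrow> real) \<Rightarrow> ('a \<Rightarrow> real) \<Rightarrow> bool" where
  "LTD M X Y \<longleftrightarrow>
     (\<forall>y. antimono_on {x. \<P>(\<omega> in M. X \<omega> \<le> x) > 0}
            (\<lambda>x. \<P>(\<omega> in M. Y \<omega> \<le> y \<bar> X \<omega> \<le> x)))"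

definition RTI :: "'a measure \<Rightarrow> ('a \<Rightarrow> real) \<Rightarrow> ('a \<Rightarrow> real) \<Rightarrow> bool" where
  "RTI M X Y \<longleftrightarrow>
     (\<forall>y. mono_on {x. \<P>(\<omega> in M. X \<omega> > x) > 0}
            (\<lambda>x. \<P>(\<omega> in M. Y \<omega> > y \<bar> X \<omega> > x)))"

definition LCSD :: "'a measure \<Rightarrow> ('a \<Rightarrow> real) \<Rightarrow> ('a \<Rightarrow> real) \<Rightarrow> bool" where
  "LCSD M X Y \<longleftrightarrow>
     (\<forall>x y.
        (\<forall>y'. antimono_on {x'. \<P>(\<omega> in M. X \<omega> \<le> x' \<and> Y \<omega> \<le> y') > 0}
           (\<lambda>x'. \<P>(\<omega> in M. X \<omega> \<le> x \<and> Y \<omega> \<le> y \<bar> X \<omega> \<le> x' \<and> Y \<omega> \<le> y'))) \<and>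
        (\<forall>x'. antimono_on {y'. \<P>(\<omega> in M. X \<omega> \<le> x' \<and> Y \<omega> \<le> y') > 0}
           (\<lambda>y'. \<P>(\<omega> in M. X \<omega> \<le> x \<and> Y \<omega> \<le> y \<bar> X \<omega> \<le> x' \<and> Y \<omega> \<le> y'))))"

definition RCSI :: "'a measure \<Rightarrow> ('a \<Rightarrow> real) \<Rightarrow> ('a \<Rightarrow> real) \<Rightarrow> bool" where
  "RCSI M X Y \<longleftrightarrow>
     (\<forall>x y.
        (\<forall>y'. mono_on {x'. \<P>(\<omega> in M. X \<omega> > x' \<and> Y \<omega> > y') > 0}
           (\<lambda>x'. \<P>(\<omega> in M. X \<omega> > x \<and> Y \<omega> > y \<bar> X \<omega> > x' \<and> Y \<omega> > y'))) \<and>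
        (\<forall>x'. mono_on {y'. \<P>(\<omega> in M. X \<omega> > x' \<and> Y \<omega> > y') > 0}
           (\<lambda>y'. \<P>(\<omega> in M. X \<omega> > x \<and> Y \<omega> > y \<bar> X \<omega> > x' \<and> Y \<omega> > y'))))"

text \<open>\<open>p\<close> is a version of the function \<open>x \<mapsto> P(A | X = x)\<close>, which is determined only up to null
  sets of the law of \<open>X\<close>: \<open>p \<circ> X\<close> is the conditional expectation of the indicator of \<open>A\<close> given
  the sigma-algebra generated by \<open>X\<close>.\<close>

definition cond_prob_version ::
  "'a measure \<Rightarrow> 'a set \<Rightarrow> ('a \<Rightarrow> real) \<Rightarrow> (real \<Rightarrow> real) \<Rightarrow> bool" where
  "cond_prob_version M A X p \<longleftrightarrow>
     p \<in> borel_measurable borel \<and>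
     (AE \<omega> in M. real_cond_exp M (vimage_algebra (space M) X borel) (indicator A) \<omega> = p (X \<omega>))"

definition SI :: "'a measure \<Rightarrow> ('a \<Rightarrow> real) \<Rightarrow> ('a \<Rightarrow> real) \<Rightarrow> bool" where
  "SI M X Y \<longleftrightarrow>
     (\<forall>y. \<exists>p. cond_prob_version M {\<omega> \<in> space M. Y \<omega> > y} X p \<and> mono p)"

definition TP2 :: "(real \<times> real \<Rightarrow> real) \<Rightarrow> bool" where
  "TP2 h \<longleftrightarrow>
     (\<forall>x1 x2 y1 y2. x1 \<le> x2 \<longrightarrow> y1 \<le> y2 \<longrightarrow>
        h (x1, y1) * h (x2, y2) - h (x1, y2) * h (x2, y1) \<ge> 0)"

text \<open>A density is a class of functions modulo equality almost everywhere; it has the property if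
  one of its versions is totally positive of order 2 at all points.\<close>

definition TP2_density :: "(real \<times> real \<Rightarrow> real) \<Rightarrow> bool" where
  "TP2_density h \<longleftrightarrow>
     (\<exists>h' \<in> borel_measurable borel. (\<forall>p. 0 \<le> h' p) \<and> (AE p in lborel. h' p = h p) \<and> TP2 h')"

abbreviation monotone_fun_on :: "real set \<Rightarrow> (real \<Rightarrow> real) \<Rightarrow> bool" where
  "monotone_fun_on A f \<equiv> mono_on A f \<or> antimono_on A f"

end

theory Submission
  imports Defs
begin

text \<open>Since \<open>\<phi>\<close> is 1-Lipschitz, both \<open>F + \<phi> \<circ> F\<close> and \<open>F - \<phi> \<circ> F\<close> are distribution functions, so
  \<open>\<phi> \<circ> F\<close> has a density \<open>a\<close> with \<open>\<bar>a\<bar> \<le> 1\<close> with respect to the law of \<open>X\<close>, where \<open>F\<close> is the distribution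
  function of \<open>X\<close>; likewise one obtains \<open>b\<close> for \<open>Y\<close>. The law of \<open>(X, Y)\<close> then has
  density \<open>1 + \<theta> a(x) b(y)\<close> with respect to the product of the marginal laws, which gives PFD and shows
  that \<open>P(Y > y | X = x)\<close> is affine in \<open>a(x)\<close>. Hence SI means that \<open>a\<close> has a monotone version,
  which happens exactly if \<open>\<phi>\<close> is convex or concave. The tail notions are read off from
  \<open>C(u, v) = u v (1 + \<theta> (\<phi>(u) / u) (\<phi>(v) / v))\<close>, and passing to \<open>(- X, - Y)\<close> and \<open>\<phi>(1 - u)\<close>
  turns the left tail notions into the right tail ones.\<close>

section \<open>Densities of functions of a distribution function\<close>

text \<open>The natural candidate for \<open>a\<close> is the derivative of \<phi> at F(x), but
  \<phi> is differentiable only almost everywhere and \<open>F\<close> may be flat on intervals; a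
  Radon-Nikodym density on the law of \<open>X\<close> avoids both. Such an \<open>a\<close> is
  fixed only up to null sets, whereas SI and TP2 ask for versions that behave well at every point.
  So the convex case gets a second construction, from slopes of supporting lines, and the converse
  is read off from integrals of a monotone version. The joint density makes \<open>F\<close> and the
  distribution function \<open>G\<close> of \<open>Y\<close> continuous, so every level strictly
  between 0 and 1 is attained; the levels 0 and 1 may not be, and are covered by \<phi>(0) =
  \<phi>(1) = 0 or by continuity of \<phi>. The same zeros decide the signs: if \<phi>(u) / u is
  monotone, or \<phi> is convex or concave, then \<phi> has constant sign, which fixes the direction
  of dependence. Total positivity meets SI in two ways: the determinant inequality integrates to SI,
  and SI gives it back through convexity and the product form of the density.\<close>

lemma (in real_distribution) lipschitz_cdf_density:
  fixes \<phi> :: "real \<Rightarrow> real"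
  assumes \<phi>0: "\<phi> 0 = 0" and \<phi>1: "\<phi> 1 = 0"
    and lip: "\<And>x y. x \<in> {0..1} \<Longrightarrow> y \<in> {0..1} \<Longrightarrow> \<bar>\<phi> x - \<phi> y\<bar> \<le> \<bar>x - y\<bar>"
  obtains a where "a \<in> borel_measurable borel" "\<And>x. \<bar>a x\<bar> \<le> 1"
    "\<And>x. \<phi> (cdf M x) = (LINT t|M. indicator {..x} t * a t)"
proof -
  define F where "F = cdf M"
  have F01: "F x \<in> {0..1}" for x
    by (simp add: F_def cdf_nonneg cdf_bounded_prob)
  have Fmono: "F x \<le> F y" if "x \<le> y" for x y
    using that by (simp add: F_def cdf_nondecreasing)
  have cont: "continuous_on {0..1} \<phi>"
    unfolding continuous_on_iff dist_real_def using lip by (meson order_le_less_trans)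
  \<comment> \<open>For \<open>s = 1\<close> and \<open>s = -1\<close> the Lipschitz bound keeps
    \<open>K s\<close> nondecreasing, and \<phi>(0) = \<phi>(1) = 0 keeps the limits 0 and 1, so
    \<open>K s\<close> is the distribution function of a probability measure \<open>P s\<close>. In
    \<open>K 1 + K (-1)\<close> the \<phi> terms cancel, which leaves 2 F.\<close>
  define K where "K s x = F x + s * \<phi> (F x)" for s x :: real
  define P where "P s = interval_measure (K s)" for s
  have Kmono: "K s x \<le> K s y" if "x \<le> y" "\<bar>s\<bar> = 1" for s x y
    using lip[OF F01[of y] F01[of x]] Fmono[OF that(1)] that(2) by (auto simp: K_def abs_if split: if_splits)
  have K_lim: "((\<lambda>x. K s x) \<longlongrightarrow> L + s * \<phi> L) A" if "(F \<longlongrightarrow> L) A" "L \<in> {0..1}" for s L A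
    unfolding K_def
    by (intro tendsto_intros continuous_on_tendsto_compose[OF cont] that always_eventually allI F01)
  have Kright: "continuous (at_right x) (K s)" for s x
    using K_lim[of "F x" "at_right x" s] F01 cdf_is_right_cont[of x]
    by (simp add: continuous_within K_def[abs_def] F_def)
  have Kbot: "(K s \<longlongrightarrow> 0) at_bot" for s
    using K_lim[of 0 at_bot s] cdf_lim_at_bot by (simp add: F_def \<phi>0)
  have Ktop: "(K s \<longlongrightarrow> 1) at_top" for s
    using K_lim[of 1 at_top s] cdf_lim_at_top_prob by (simp add: F_def \<phi>1)
  have P_dist: "real_distribution (P s)" if "\<bar>s\<bar> = 1" for s
    unfolding P_def by (intro real_distribution_interval_measure Kmono Kright Kbot Ktop that)
  have P_cdf: "cdf (P s) = K s" if "\<bar>s\<bar> = 1" for s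
    unfolding P_def by (intro cdf_interval_measure Kmono Kright Kbot that)
  interpret P: real_distribution "P 1" by (rule P_dist) simp
  interpret Q: real_distribution "P (-1)" by (rule P_dist) simp
  have prob_iff: "emeasure (P 1) A + emeasure (P (-1)) A = 2 * emeasure M A \<longleftrightarrow>
      P.prob A + Q.prob A = 2 * prob A" for A
  proof -
    have "2 * ennreal (prob A) = ennreal (2 * prob A)" by (simp add: ennreal_mult)
    then show ?thesis
      by (simp add: P.emeasure_eq_measure Q.emeasure_eq_measure emeasure_eq_measure flip: ennreal_plus)
  qed
  \<comment> \<open>The identity of distribution functions is carried from half-open intervals to
    all Borel sets by a Dynkin argument. It yields absolute continuity and, further down, the bound
    2 on the density.\<close>
  have sum: "emeasure (P 1) A + emeasure (P (-1)) A = 2 * emeasure M A" if "A \<in> sets borel" for A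
  proof -
    have "Int_stable (range (\<lambda>(a, b). {a<..b::real}))" by (auto simp: Int_stable_def)
    moreover have "range (\<lambda>(a, b). {a<..b::real}) \<subseteq> Pow UNIV" by simp
    moreover have "A \<in> sigma_sets UNIV (range (\<lambda>(a, b). {a<..b::real}))"
      using that by (simp add: borel_sigma_sets_Ioc)
    ultimately show ?thesis
    proof (induction rule: sigma_sets_induct_disjoint)
      case (basic A)
      then obtain a b where A: "A = {a<..b}" by auto
      show ?case
      proof (cases "a < b")
        case True
        have "P.prob A + Q.prob A = 2 * prob A"
          using P.cdf_diff_eq[OF True] Q.cdf_diff_eq[OF True] cdf_diff_eq[OF True]
          by (simp add: A P_cdf F_def[symmetric] K_def)
        then show ?thesis by (simp only: prob_iff)
      qed (simp add: A)
    next
      case (compl A)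
      then have A: "A \<in> sets borel" by (simp add: borel_sigma_sets_Ioc)
      have "P.prob A + Q.prob A = 2 * prob A"
        using compl.IH by (simp only: prob_iff)
      then have "P.prob (UNIV - A) + Q.prob (UNIV - A) = 2 * prob (UNIV - A)"
        using A P.prob_compl[of A] Q.prob_compl[of A] prob_compl[of A] by simp
      then show ?case by (simp only: prob_iff)
    next
      case (union A)
      then have A: "range A \<subseteq> sets borel" "disjoint_family A" by (auto simp: borel_sigma_sets_Ioc)
      then show ?case using union.IH
        by (simp add: suminf_emeasure[symmetric] suminf_add ennreal_suminf_cmult)
    qed auto
  qed
  have ac: "absolutely_continuous M (P 1)" "absolutely_continuous M (P (-1))"
    using sum by (auto simp: absolutely_continuous_def null_sets_def) (metis add_eq_0_iff_both_eq_0 mult_zero_right)+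
  obtain k where k: "k \<in> borel_measurable M" "density M k = P 1"
    using Radon_Nikodym[OF ac(1)] by auto
  obtain l where l: "l \<in> borel_measurable M" "density M l = P (-1)"
    using Radon_Nikodym[OF ac(2)] by auto
  have "density M (\<lambda>x. k x + l x) = density M (\<lambda>x. 2)"
  proof (rule measure_eqI)
    fix A assume "A \<in> sets (density M (\<lambda>x. k x + l x))"
    then have A: "A \<in> sets M" by simp
    have "emeasure (density M (\<lambda>x. k x + l x)) A = emeasure (density M k) A + emeasure (density M l) A"
      using A k(1) l(1) by (simp add: emeasure_density nn_integral_add distrib_right)
    also have "\<dots> = 2 * emeasure M A" using A sum k l by simp
    finally show "emeasure (density M (\<lambda>x. k x + l x)) A = emeasure (density M (\<lambda>x. 2)) A"
      using A by (simp add: emeasure_density nn_integral_cmult)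
  qed simp
  then have "AE x in M. k x + l x = 2"
    using k(1) l(1) by (subst (asm) density_unique_iff) auto
  then have AEk: "AE x in M. k x = min 2 (k x)"
    by eventually_elim (metis add_increasing2 min_def order_refl zero_le min.absorb2)
  \<comment> \<open>The density \<open>k\<close> is at most 2 only almost everywhere; cutting it off
    at 2 makes \<open>\<bar>a x\<bar> \<le> 1\<close> true at every point without changing the
    measure.\<close>
  define a where "a x = enn2real (min 2 (k x)) - 1" for x
  have a_k: "ennreal (1 + a x) = min 2 (k x)" for x
    using order.strict_trans[of "k x" 2 top] by (auto simp: a_def min_def not_le)
  have meas [measurable]: "a \<in> borel_measurable M" unfolding a_def using k(1) by measurable
  have bd: "\<bar>a x\<bar> \<le> 1" for x
  proof -
    have "enn2real (min 2 (k x)) \<le> enn2real 2" by (rule enn2real_mono) auto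
    then show ?thesis by (simp add: a_def abs_if)
  qed
  have Pd: "P 1 = density M (\<lambda>x. ennreal (1 + a x))"
    unfolding a_k k(2)[symmetric] using k(1) AEk by (intro density_cong) auto
  have ge: "0 \<le> 1 + a x" for x using bd[of x] by (simp add: abs_le_iff)
  have "\<phi> (cdf M x) = (LINT t|M. indicator {..x} t * a t)" for x
  proof -
    have int: "integrable M (\<lambda>t. indicator {..x} t * a t)" "integrable M (indicator {..x} :: _ \<Rightarrow> real)"
      by (auto intro!: integrable_const_bound[of _ 1] simp: bd abs_mult indicator_def)
    have "K 1 x = measure (P 1) {..x}" using P_cdf[of 1] by (simp add: cdf_def fun_eq_iff)
    also have "\<dots> = (LINT t|P 1. indicator {..x} t)" by simp
    also have "\<dots> = (LINT t|M. (1 + a t) *\<^sub>R indicator {..x} t)"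
      unfolding Pd by (rule integral_density) (use ge in auto)
    also have "\<dots> = (LINT t|M. indicator {..x} t + indicator {..x} t * a t)"
      by (simp add: algebra_simps)
    also have "\<dots> = F x + (LINT t|M. indicator {..x} t * a t)"
      using int by (simp add: F_def cdf_def)
    finally show ?thesis by (simp add: K_def F_def)
  qed
  moreover have "a \<in> borel_measurable borel" using meas by simp
  ultimately show thesis using that bd by blast
qed

section \<open>Monotone densities and convexity\<close>

lemma lipschitz_convex_subgradient:
  fixes \<phi> :: "real \<Rightarrow> real"
  assumes convex: "convex_on {0..1} \<phi>" and u: "u \<in> {0..1}"
    and lip: "\<And>x y. x \<in> {0..1} \<Longrightarrow> y \<in> {0..1} \<Longrightarrow> \<bar>\<phi> x - \<phi> y\<bar> \<le> \<bar>x - y\<bar>"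
  obtains s where "\<bar>s\<bar> \<le> 1" "\<And>y. y \<in> {0..1} \<Longrightarrow> \<phi> u + s * (y - u) \<le> \<phi> y"
proof -
  consider "u = 0" | "u = 1" | "0 < u" "u < 1" using u by force
  then show thesis
  proof cases
    \<comment> \<open>At the endpoints the Lipschitz bound itself provides a supporting line, of
      slope -1 at 0 and 1 at 1; the right-hand difference quotients used in the interior would run
      over an empty set at 1.\<close>
    case 1
    show thesis
    proof (rule that[of "-1"])
      fix y :: real assume "y \<in> {0..1}"
      then show "\<phi> u + -1 * (y - u) \<le> \<phi> y" using lip[of y 0] 1 by auto
    qed simp
  next
    case 2
    show thesis
    proof (rule that[of 1])
      fix y :: real assume "y \<in> {0..1}"
      then show "\<phi> u + 1 * (y - u) \<le> \<phi> y" using lip[of y 1] 2 by auto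
    qed simp
  next
    case 3
    \<comment> \<open>This is the right derivative of \<phi> at \<open>u\<close>. Testing its
      supporting line at the points 1 and 0 bounds the slope by 1 and -1.\<close>
    define s where "s = Inf ((\<lambda>t. (\<phi> u - \<phi> t) / (u - t)) ` ({u<..} \<inter> {0..1}))"
    have sub: "\<phi> u + s * (y - u) \<le> \<phi> y" if "y \<in> {0..1}" for y
      unfolding s_def by (rule convex_le_Inf_differential[OF convex]) (use 3 that in auto)
    have "\<bar>\<phi> 1 - \<phi> u\<bar> \<le> 1 - u" "\<phi> u + s * (1 - u) \<le> \<phi> 1"
      using lip[of 1 u] sub[of 1] 3 by auto
    then have "s * (1 - u) \<le> 1 * (1 - u)" by (metis abs_le_D1 add.commute le_diff_eq mult_1 order_trans)
    then have "s \<le> 1" by (rule mult_right_le_imp_le) (use 3 in simp)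
    moreover have "-1 * u \<le> s * u" using sub[of 0] lip[of 0 u] 3 by auto
    then have "-1 \<le> s" by (rule mult_right_le_imp_le) (use 3 in simp)
    ultimately show thesis using sub that by (simp add: abs_le_iff)
  qed
qed

text \<open>\<open>I y - I x\<close> integrates \<open>a\<close> over the interval from
  \<open>x\<close> (excluded) to \<open>y\<close> (included), where monotonicity keeps
  \<open>a\<close> between its two end values. Read in the variable \<open>cdf M\<close>, this says
  that \<open>a x\<close> is the slope of a supporting line of \<open>I\<close>.\<close>

lemma (in real_distribution) integral_mono_Ioc_bounds:
  fixes a :: "real \<Rightarrow> real"
  assumes mono: "mono a" and bd: "\<And>x. \<bar>a x\<bar> \<le> 1" and "x \<le> y"
  defines "I \<equiv> \<lambda>z. LINT t|M. indicator {..z} t * a t"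
  shows "a x * (cdf M y - cdf M x) \<le> I y - I x" and "I y - I x \<le> a y * (cdf M y - cdf M x)"
proof -
  have [measurable]: "a \<in> borel_measurable borel" using mono by (rule borel_measurable_mono)
  have int: "integrable M (\<lambda>t. indicator A t * a t)" if "A \<in> sets borel" for A
    using that bd by (auto intro!: integrable_const_bound[of _ 1] simp: abs_mult indicator_def)
  have "I y - I x = (LINT t|M. indicator {..y} t * a t - indicator {..x} t * a t)"
    unfolding I_def by (rule Bochner_Integration.integral_diff[symmetric]) (auto intro: int)
  also have "\<dots> = (LINT t|M. indicator {x<..y} t * a t)"
    using \<open>x \<le> y\<close> by (intro Bochner_Integration.integral_cong) (auto simp: indicator_def)
  finally have I: "I y - I x = (LINT t|M. indicator {x<..y} t * a t)" .
  have F: "c * (cdf M y - cdf M x) = (LINT t|M. indicator {x<..y} t * c)" for c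
    using cdf_diff_eq[of x y] \<open>x \<le> y\<close> by (cases "x = y") auto
  have int': "integrable M (\<lambda>t. indicator {x<..y} t * c)" for c :: real
    by (rule integrable_const_bound[of _ "\<bar>c\<bar>"]) (auto simp: indicator_def)
  show "a x * (cdf M y - cdf M x) \<le> I y - I x" "I y - I x \<le> a y * (cdf M y - cdf M x)"
    unfolding I F
    by (rule integral_mono[OF int' int] integral_mono[OF int int'];
        use mono in \<open>auto simp: indicator_def mono_def\<close>)+
qed

lemma constant_if_increments_le_product:
  fixes E F a :: "real \<Rightarrow> real"
  assumes cont: "\<And>x. isCont F x" and F: "mono F" and a: "mono a" and bd: "\<And>x. \<bar>a x\<bar> \<le> 1"
    and E: "\<And>x y. x \<le> y \<Longrightarrow> \<bar>E y - E x\<bar> \<le> (a y - a x) * (F y - F x)"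
    and "x \<le> y"
  shows "E x = E y"
  \<comment> \<open>cut the interval at points where \<open>F\<close> increases in \<open>n\<close> equal steps; the increments of \<open>a\<close> telescope\<close>
proof (cases "F x = F y")
  case True
  then show ?thesis using E[OF \<open>x \<le> y\<close>] by simp
next
  case False
  define d where "d = F y - F x"
  have d: "0 < d" using False F \<open>x \<le> y\<close> by (auto simp: d_def less_le mono_def)
  have "\<bar>E y - E x\<bar> \<le> 2 * d / real n" if n: "n > 0" for n :: nat
  proof -
    have "\<exists>z. x \<le> z \<and> z \<le> y \<and> F z = F x + real i / real n * d" if "i \<le> n" for i
    proof (rule IVT)
      have "real i / real n * d \<le> 1 * d" by (rule mult_right_mono) (use d n that in auto)
      then show "F x + real i / real n * d \<le> F y" by (simp add: d_def)
    qed (use d n \<open>x \<le> y\<close> cont in auto)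
    then obtain z where z: "\<And>i. i \<le> n \<Longrightarrow> x \<le> z i \<and> z i \<le> y \<and> F (z i) = F x + real i / real n * d"
      by metis
    have step: "\<bar>E (z (Suc i)) - E (z i)\<bar> \<le> (a (z (Suc i)) - a (z i)) * (d / real n)" if "i < n" for i
    proof -
      have diff: "F (z (Suc i)) - F (z i) = d / real n"
        using z[of i] z[of "Suc i"] that n by (simp add: field_simps)
      then have "F (z i) < F (z (Suc i))" using d n by (simp add: algebra_simps) 
      then have "z i \<le> z (Suc i)" using F by (meson linorder_not_less monoD nle_le)
      then show ?thesis using E[of "z i" "z (Suc i)"] diff by simp
    qed
    \<comment> \<open>\<open>z 0\<close> and \<open>z n\<close> need not be \<open>x\<close> and
      \<open>y\<close>, but \<open>F\<close> takes the same values there, so the assumed bound on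
      the increments of \<open>E\<close> is 0.\<close>
    have "E x = E (z 0)" using E[of x "z 0"] z[of 0] by simp
    moreover have "E y = E (z n)" using E[of "z n" y] z[of n] n by (simp add: d_def)
    ultimately have "\<bar>E y - E x\<bar> = \<bar>\<Sum>i<n. E (z (Suc i)) - E (z i)\<bar>"
      by (simp only: sum_lessThan_telescope[of "\<lambda>i. E (z i)"])
    also have "\<dots> \<le> (\<Sum>i<n. (a (z (Suc i)) - a (z i)) * (d / real n))"
      by (rule order.trans[OF sum_abs sum_mono]) (use step in auto)
    also have "\<dots> = (a (z n) - a (z 0)) * (d / real n)"
      by (simp only: sum_distrib_right[symmetric] sum_lessThan_telescope[of "\<lambda>i. a (z i)"])
    also have "\<dots> \<le> 2 * (d / real n)"
      by (rule mult_right_mono) (use bd[of "z n"] bd[of "z 0"] d in auto)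
    finally show ?thesis by simp
  qed
  then have *: "\<bar>E y - E x\<bar> \<le> 2 * d / real (Suc n)" for n by blast
  have "(\<lambda>n. 2 * d / real (Suc n)) \<longlonglongrightarrow> 0"
    by (rule LIMSEQ_Suc[OF lim_const_over_n])
  then have "\<bar>E y - E x\<bar> \<le> 0"
    by (rule LIMSEQ_le_const) (use * in auto)
  then show ?thesis by simp
qed

text \<open>The density is the slope \<open>D\<close> of a supporting line of \<phi>, taken at F(x).
  It depends on F(x) alone, hence is constant where \<open>F\<close> is flat. That it represents
  \<phi> follows from comparing increments: \<phi> composed with \<open>F\<close> and the integral
  of \<open>a\<close> obey the same two-sided bounds.\<close>

lemma (in real_distribution) convex_cdf_density:
  fixes \<phi> :: "real \<Rightarrow> real"
  assumes cont: "\<And>x. isCont (cdf M) x" and \<phi>0: "\<phi> 0 = 0"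
    and lip: "\<And>x y. x \<in> {0..1} \<Longrightarrow> y \<in> {0..1} \<Longrightarrow> \<bar>\<phi> x - \<phi> y\<bar> \<le> \<bar>x - y\<bar>"
    and convex: "convex_on {0..1} \<phi>"
  obtains a where "mono a" "\<And>x. \<bar>a x\<bar> \<le> 1"
    "\<And>x. \<phi> (cdf M x) = (LINT t|M. indicator {..x} t * a t)"
proof -
  have "\<exists>s. \<bar>s\<bar> \<le> 1 \<and> (\<forall>y\<in>{0..1}. \<phi> u + s * (y - u) \<le> \<phi> y)" if "u \<in> {0..1}" for u
    using lipschitz_convex_subgradient[OF convex that lip] by metis
  then obtain D where D: "\<And>u. u \<in> {0..1} \<Longrightarrow> \<bar>D u\<bar> \<le> 1"
    "\<And>u y. u \<in> {0..1} \<Longrightarrow> y \<in> {0..1} \<Longrightarrow> \<phi> u + D u * (y - u) \<le> \<phi> y" by metis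
  define F where "F = cdf M"
  have F01: "F x \<in> {0..1}" for x
    by (simp add: F_def cdf_nonneg cdf_bounded_prob)
  have Fmono: "mono F" by (simp add: F_def cdf_nondecreasing mono_def)
  define a where "a x = D (F x)" for x
  have bd: "\<bar>a x\<bar> \<le> 1" for x using D(1) F01 by (simp add: a_def)
  have lower: "\<phi> (F x) + a x * (F y - F x) \<le> \<phi> (F y)" for x y
    using D(2)[OF F01 F01] by (simp add: a_def)
  have "mono a"
  proof
    fix x y :: real assume "x \<le> y"
    then have "F x \<le> F y" using Fmono by (simp add: mono_def)
    moreover have "a x \<le> a y" if "F x < F y"
    proof -
      have "a x * (F y - F x) \<le> a y * (F y - F x)"
        using lower[of x y] lower[of y x] by (simp add: algebra_simps)
      then show ?thesis using that by simp
    qed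
    moreover have "a x = a y" if "F x = F y" using that by (simp add: a_def)
    ultimately show "a x \<le> a y" by fastforce
  qed
  define I where "I z = (LINT t|M. indicator {..z} t * a t)" for z
  define E where "E x = \<phi> (F x) - I x" for x
  \<comment> \<open>Both increments lie between \<open>a x * (F y - F x)\<close> and
    \<open>a y * (F y - F x)\<close>, so they differ by at most the length of that interval; this is
    the hypothesis that makes \<open>E\<close> constant.\<close>
  have inc: "\<bar>E y - E x\<bar> \<le> (a y - a x) * (F y - F x)" if "x \<le> y" for x y
    using integral_mono_Ioc_bounds[OF \<open>mono a\<close> bd that] lower[of x y] lower[of y x]
    by (auto simp: E_def I_def F_def abs_le_iff algebra_simps)
  have E_const: "E x = E y" if "x \<le> y" for x y
    using constant_if_increments_le_product[of F a E, OF _ Fmono \<open>mono a\<close> bd inc that] cont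
    by (simp add: F_def)
  \<comment> \<open>Since \<open>E\<close> is constant, a bound that vanishes at minus infinity
    forces it to be 0.\<close>
  have small: "\<bar>E x\<bar> \<le> 2 * F x" for x
  proof -
    have [measurable]: "a \<in> borel_measurable borel" using \<open>mono a\<close> by (rule borel_measurable_mono)
    have "\<bar>I x\<bar> \<le> (LINT t|M. \<bar>indicator {..x} t * a t\<bar>)" unfolding I_def by (rule integral_abs_bound)
    also have "\<dots> \<le> (LINT t|M. indicator {..x} t)"
      by (rule integral_mono) (use bd in \<open>auto intro!: integrable_const_bound[of _ 1] simp: abs_mult indicator_def\<close>)
    finally have "\<bar>I x\<bar> \<le> F x" by (simp add: F_def cdf_def)
    moreover have "\<bar>\<phi> (F x)\<bar> \<le> F x" using lip[OF F01[of x], of 0] F01[of x] \<phi>0 by simp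
    ultimately show ?thesis by (simp add: E_def abs_le_iff)
  qed
  have "\<phi> (cdf M x) = (LINT t|M. indicator {..x} t * a t)" for x
  proof -
    have "((\<lambda>y. 2 * F y) \<longlongrightarrow> 2 * 0) at_bot"
      unfolding F_def by (intro tendsto_intros cdf_lim_at_bot)
    moreover have "eventually (\<lambda>y. \<bar>E x\<bar> \<le> 2 * F y) at_bot"
      using eventually_le_at_bot[of x] by eventually_elim (use E_const small in metis)
    ultimately have "\<bar>E x\<bar> \<le> 2 * 0" by (rule tendsto_lowerbound) simp
    then show ?thesis by (simp add: E_def I_def F_def)
  qed
  then show thesis using that \<open>mono a\<close> bd by blast
qed

lemma (in real_distribution) cdf_attains:
  assumes cont: "\<And>x. isCont (cdf M) x" and "0 < u" "u < 1"
  obtains x where "cdf M x = u"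
proof -
  obtain a b where "cdf M a < u" "u < cdf M b"
    using order_tendstoD(2)[OF cdf_lim_at_bot \<open>0 < u\<close>] order_tendstoD(1)[OF cdf_lim_at_top_prob \<open>u < 1\<close>]
      eventually_happens'[of at_bot] eventually_happens'[of at_top] by fastforce
  moreover from this have "a \<le> b" using cdf_nondecreasing[of b a] by linarith
  ultimately show thesis using IVT[of "cdf M" a u b] cont that by force
qed

text \<open>Each \<open>a x\<close> is the slope of a supporting line of \<phi> at
  \<open>cdf M x\<close>, and a function with supporting lines at all interior points and continuous
  up to the ends is convex.\<close>

lemma (in real_distribution) convex_if_mono_cdf_density:
  fixes \<phi> a :: "real \<Rightarrow> real"
  assumes cont: "\<And>x. isCont (cdf M) x" and cont_\<phi>: "continuous_on {0..1} \<phi>"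
    and a: "mono a" and bd: "\<And>x. \<bar>a x\<bar> \<le> 1"
    and I: "\<And>x. \<phi> (cdf M x) = (LINT t|M. indicator {..x} t * a t)"
  shows "convex_on {0..1} \<phi>"
proof -
  have F01: "cdf M x \<in> {0..1}" for x
    by (simp add: cdf_nonneg cdf_bounded_prob)
  have sub: "\<phi> (cdf M x) + a x * (w - cdf M x) \<le> \<phi> w" if w: "w \<in> {0..1}" for x w
  proof -
    have *: "\<phi> (cdf M x) + a x * (cdf M t - cdf M x) \<le> \<phi> (cdf M t)" for t
      using integral_mono_Ioc_bounds(1)[OF a bd, of x t, folded I] integral_mono_Ioc_bounds(2)[OF a bd, of t x, folded I]
      by (cases "x \<le> t") (auto simp: algebra_simps)
    have lim: ?thesis if "(cdf M \<longlongrightarrow> w) A" "A \<noteq> bot" for A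
    proof (rule tendsto_le)
      show "((\<lambda>t. \<phi> (cdf M t)) \<longlongrightarrow> \<phi> w) A"
        by (rule continuous_on_tendsto_compose[OF cont_\<phi> that(1) w]) (use F01 in auto)
      show "((\<lambda>t. \<phi> (cdf M x) + a x * (cdf M t - cdf M x)) \<longlongrightarrow> \<phi> (cdf M x) + a x * (w - cdf M x)) A"
        by (intro tendsto_intros that)
    qed (use * that in auto)
    \<comment> \<open>The values 0 and 1 may be missed by the distribution function; they are its
      limits, and the inequality survives the limit because \<phi> is continuous.\<close>
    consider "w = 0" | "w = 1" | "0 < w" "w < 1" using w by force
    then show ?thesis
    proof cases
      case 3
      then show ?thesis using cdf_attains[OF cont] * by metis
    qed (use lim[of at_bot] lim[of at_top] cdf_lim_at_bot cdf_lim_at_top_prob in auto)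
  qed
  show ?thesis
  proof (rule convex_onI)
    fix t u v :: real assume t: "0 < t" "t < 1" and uv: "u \<in> {0..1}" "v \<in> {0..1}"
    define z where "z = (1 - t) * u + t * v"
    show "\<phi> ((1 - t) *\<^sub>R u + t *\<^sub>R v) \<le> (1 - t) * \<phi> u + t * \<phi> v"
    proof (cases "u = v")
      case False
      have "0 < z"
        using t uv False unfolding z_def by (cases "u = 0") (auto intro: add_nonneg_pos add_pos_nonneg)
      moreover have "z < 1"
      proof -
        have "0 < (1 - t) * (1 - u) + t * (1 - v)"
          using t uv False by (cases "u = 1") (auto intro: add_nonneg_pos add_pos_nonneg)
        then show ?thesis by (simp add: z_def algebra_simps)
      qed
      ultimately obtain x where x: "cdf M x = z" using cdf_attains[OF cont] by metis
      \<comment> \<open>The supporting line at \<open>z\<close> is averaged over \<open>u\<close>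
        and \<open>v\<close>; its slope cancels because
        \<open>(1 - t) * (u - z) + t * (v - z) = 0\<close>.\<close>
      have "(1 - t) * (\<phi> z + a x * (u - z)) + t * (\<phi> z + a x * (v - z)) \<le> (1 - t) * \<phi> u + t * \<phi> v"
        by (intro add_mono mult_left_mono sub[of _ x, unfolded x]) (use t uv in auto)
      moreover have "(1 - t) * (\<phi> z + a x * (u - z)) + t * (\<phi> z + a x * (v - z)) = \<phi> z"
        by (simp add: z_def algebra_simps)
      ultimately show ?thesis by (simp add: z_def)
    qed (simp add: algebra_simps)
  qed simp
qed

section \<open>The joint law\<close>

lemma measure_eqI_quadrants:
  fixes P Q :: "(real \<times> real) measure"
  assumes sets: "sets P = sets borel" "sets Q = sets borel"
    and fin: "finite_measure P" "finite_measure Q"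
    and eq: "\<And>x y. measure P ({..x} \<times> {..y}) = measure Q ({..x} \<times> {..y})"
  shows "P = Q"
proof (rule measure_eqI_generator_eq[where \<Omega> = UNIV and E = "range atMost" and A = "\<lambda>n. {..(real n, real n)}"])
  have quadrant: "{..p} = {..fst p} \<times> {..snd p}" for p :: "real \<times> real"
    by (auto simp: less_eq_prod_def)
  show "Int_stable (range (atMost :: real \<times> real \<Rightarrow> _))"
  proof (rule Int_stableI)
    fix A B :: "(real \<times> real) set" assume "A \<in> range atMost" "B \<in> range atMost"
    then obtain p q where "A = {..p}" "B = {..q}" by auto
    then have "A \<inter> B = {..inf p q}" by auto
    then show "A \<inter> B \<in> range atMost" by simp
  qed
  show "emeasure P A = emeasure Q A" if "A \<in> range atMost" for A
    using that eq fin by (auto simp: finite_measure.emeasure_eq_measure quadrant)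
  show "sets P = sigma_sets UNIV (range atMost)" "sets Q = sigma_sets UNIV (range atMost)"
    using sets by (simp_all add: borel_eq_atMost)
  show "(\<Union>n. {..(real n, real n)}) = UNIV"
  proof (intro equalityI subsetI)
    fix p :: "real \<times> real"
    obtain n where "max (fst p) (snd p) \<le> real n" using real_arch_simple by blast
    then show "p \<in> (\<Union>n. {..(real n, real n)})" by (auto simp: less_eq_prod_def)
  qed simp
  show "emeasure P {..(real n, real n)} \<noteq> \<infinity>" for n
    using fin(1) by (simp add: finite_measure.emeasure_eq_measure)
qed auto

lemma (in pair_prob_space)
  fixes f :: "'a \<Rightarrow> real" and g :: "'b \<Rightarrow> real"
  assumes f: "integrable M1 f" and g: "integrable M2 g"
  shows integrable_pair_mult: "integrable (M1 \<Otimes>\<^sub>M M2) (\<lambda>(x, y). f x * g y)"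
    and integral_pair_mult: "(\<integral>(x, y). f x * g y \<partial>(M1 \<Otimes>\<^sub>M M2)) = (\<integral>x. f x \<partial>M1) * (\<integral>y. g y \<partial>M2)"
proof -
  have [measurable]: "f \<in> borel_measurable M1" "g \<in> borel_measurable M2"
    using f g by auto
  show int: "integrable (M1 \<Otimes>\<^sub>M M2) (\<lambda>(x, y). f x * g y)"
    by (rule Fubini_integrable) (use f g in \<open>auto simp: abs_mult\<close>)
  show "(\<integral>(x, y). f x * g y \<partial>(M1 \<Otimes>\<^sub>M M2)) = (\<integral>x. f x \<partial>M1) * (\<integral>y. g y \<partial>M2)"
    using integral_fst'[OF int] by simp
qed

text \<open>Of the joint density only the continuity of both distribution functions is recorded. The
  pairs \<open>(Y, X)\<close> and \<open>(- X, - Y)\<close> are then instances again, by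
  \<open>swapped\<close> and \<open>reflected\<close>, which yields the exchanged versions and the
  right tail results.\<close>

locale lipschitz_copula_pair = prob_space M
  for M :: "'a measure" +
  fixes X Y :: "'a \<Rightarrow> real" and \<phi> :: "real \<Rightarrow> real" and \<theta> :: real
  assumes \<phi>0: "\<phi> 0 = 0" and \<phi>1: "\<phi> 1 = 0"
    and lip: "\<And>x y. x \<in> {0..1} \<Longrightarrow> y \<in> {0..1} \<Longrightarrow> \<bar>\<phi> x - \<phi> y\<bar> \<le> \<bar>x - y\<bar>"
    and \<theta>_pos: "0 < \<theta>" and \<theta>_le: "\<theta> \<le> 1"
    and rv_X [measurable]: "random_variable borel X" and rv_Y [measurable]: "random_variable borel Y"
    and copula: "has_copula M X Y (copula_family \<phi> \<theta>)"
    and cont_X: "\<And>x. isCont (cdf (distr M borel X)) x"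
    and cont_Y: "\<And>y. isCont (cdf (distr M borel Y)) y"
begin

sublocale DX: real_distribution "distr M borel X" by (rule real_distribution_distr) simp
sublocale DY: real_distribution "distr M borel Y" by (rule real_distribution_distr) simp
sublocale DXY: pair_prob_space "distr M borel X" "distr M borel Y" ..

abbreviation F where "F \<equiv> cdf (distr M borel X)"
abbreviation G where "G \<equiv> cdf (distr M borel Y)"

lemma F01: "0 \<le> F x" "F x \<le> 1" and G01: "0 \<le> G x" "G x \<le> 1"
  by (simp_all add: DX.cdf_nonneg DX.cdf_bounded_prob DY.cdf_nonneg DY.cdf_bounded_prob)

lemma prob_X_le: "prob {\<omega> \<in> space M. X \<omega> \<le> x} = F x"
  and prob_Y_le: "prob {\<omega> \<in> space M. Y \<omega> \<le> y} = G y"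
  by (simp_all add: cdf_def measure_distr vimage_def Int_def conj_commute)

lemma prob_XY_le: "prob {\<omega> \<in> space M. X \<omega> \<le> x \<and> Y \<omega> \<le> y} = F x * G y + \<theta> * \<phi> (F x) * \<phi> (G y)"
  using copula by (simp add: has_copula_def copula_family_def)

lemma continuous_\<phi>: "continuous_on {0..1} \<phi>"
  unfolding continuous_on_iff dist_real_def using lip by (meson order_le_less_trans)

lemma swapped: "lipschitz_copula_pair M Y X \<phi> \<theta>"
  using copula
  by unfold_locales
    (auto simp: \<phi>0 \<phi>1 lip \<theta>_pos \<theta>_le cont_X cont_Y has_copula_def copula_family_def conj_commute mult_ac)

lemma sets_pair: "sets (distr M borel X \<Otimes>\<^sub>M distr M borel Y) = sets (borel :: (real \<times> real) measure)"
  unfolding borel_prod[symmetric] by (intro sets_pair_measure_cong sets_distr)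

text \<open>\<open>a\<close> stands for \<phi>' at the distribution function of \<open>D\<close>, in
  integrated form. Being a predicate, it admits any version, in particular a monotone one. The bound
  is asked at every point, so that the joint factor is nonnegative everywhere.\<close>

definition margin_density :: "real measure \<Rightarrow> (real \<Rightarrow> real) \<Rightarrow> bool" where
  "margin_density D a \<longleftrightarrow> a \<in> borel_measurable borel \<and> (\<forall>x. \<bar>a x\<bar> \<le> 1) \<and>
     (\<forall>x. \<phi> (cdf D x) = (LINT t|D. indicator {..x} t * a t))"

lemma joint_factor_bounds:
  assumes "margin_density D a" "margin_density E b"
  shows "0 \<le> 1 + \<theta> * a x * b y" "1 + \<theta> * a x * b y \<le> 2"
proof -
  have "\<bar>\<theta> * a x * b y\<bar> \<le> 1"
    unfolding abs_mult using assms \<theta>_pos \<theta>_le by (auto simp: margin_density_def intro!: mult_le_one)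
  then show "0 \<le> 1 + \<theta> * a x * b y" "1 + \<theta> * a x * b y \<le> 2" by (auto simp: abs_le_iff)
qed

text \<open>Both summands of the density are products of a function of \<open>x\<close> and one of
  \<open>y\<close>, so the integral over a rectangle factorizes. Quadrants identify the joint law; a
  general \<open>A\<close> serves for conditioning on \<open>X\<close>.\<close>

lemma measure_density_rectangle:
  assumes a: "margin_density (distr M borel X) a" and b: "margin_density (distr M borel Y) b"
    and [measurable]: "A \<in> sets borel" "B \<in> sets borel"
  shows "measure (density (distr M borel X \<Otimes>\<^sub>M distr M borel Y) (\<lambda>(x, y). ennreal (1 + \<theta> * a x * b y))) (A \<times> B) =
    measure (distr M borel X) A * measure (distr M borel Y) B
    + \<theta> * ((LINT t|distr M borel X. indicator A t * a t) * (LINT t|distr M borel Y. indicator B t * b t))"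
    (is "measure (density ?D ?d) _ = _")
proof -
  have [measurable]: "a \<in> borel_measurable borel" "b \<in> borel_measurable borel"
    using a b by (simp_all add: margin_density_def)
  have bd: "\<bar>a x\<bar> \<le> 1" "\<bar>b x\<bar> \<le> 1" for x
    using a b by (simp_all add: margin_density_def)
  have int: "integrable (distr M borel X) (\<lambda>t. indicator A t * a t)"
      "integrable (distr M borel X) (indicator A :: _ \<Rightarrow> real)"
      "integrable (distr M borel Y) (\<lambda>t. indicator B t * b t)"
      "integrable (distr M borel Y) (indicator B :: _ \<Rightarrow> real)"
    by (auto intro!: DX.integrable_const_bound[of _ 1] DY.integrable_const_bound[of _ 1]
        simp: bd abs_mult indicator_def)
  have meas: "A \<times> B \<in> sets (borel \<Otimes>\<^sub>M borel :: (real \<times> real) measure)"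
    by simp
  have "measure (density ?D ?d) (A \<times> B) = (\<integral>p. indicator (A \<times> B) p \<partial>density ?D ?d)"
    using meas by (simp add: sets_pair borel_prod)
  also have "\<dots> = (\<integral>p. (1 + \<theta> * a (fst p) * b (snd p)) *\<^sub>R indicator (A \<times> B) p \<partial>?D)"
    unfolding case_prod_beta
    by (rule integral_density) (use meas joint_factor_bounds[OF a b] in auto)
  also have "\<dots> = (\<integral>p. (\<lambda>(s, t). indicator A s * indicator B t) p
      + \<theta> * (\<lambda>(s, t). (indicator A s * a s) * (indicator B t * b t)) p \<partial>?D)"
    by (rule Bochner_Integration.integral_cong) (auto simp: indicator_def of_bool_def split: if_splits)
  also have "\<dots> = measure (distr M borel X) A * measure (distr M borel Y) B
    + \<theta> * ((LINT t|distr M borel X. indicator A t * a t) * (LINT t|distr M borel Y. indicator B t * b t))"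
    using DXY.integrable_pair_mult[OF int(2,4)] DXY.integrable_pair_mult[OF int(1,3)]
      DXY.integral_pair_mult[OF int(2,4)] DXY.integral_pair_mult[OF int(1,3)]
    by simp
  finally show ?thesis .
qed

text \<open>On a quadrant the two integrals are \<phi>(F(x)) and \<phi>(G(y)), so the density
  reproduces the copula formula, and quadrants determine a finite measure on the plane.\<close>

lemma joint_law:
  assumes a: "margin_density (distr M borel X) a" and b: "margin_density (distr M borel Y) b"
  shows "distr M (borel \<Otimes>\<^sub>M borel) (\<lambda>\<omega>. (X \<omega>, Y \<omega>)) =
    density (distr M borel X \<Otimes>\<^sub>M distr M borel Y) (\<lambda>(x, y). ennreal (1 + \<theta> * a x * b y))"
    (is "?P = density ?D ?d")
proof (rule measure_eqI_quadrants)
  have [measurable]: "a \<in> borel_measurable borel" "b \<in> borel_measurable borel"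
    using a b by (simp_all add: margin_density_def)
  show "sets ?P = sets (borel :: (real \<times> real) measure)" "sets (density ?D ?d) = sets borel"
    by (simp_all only: sets_distr sets_density sets_pair borel_prod)
  show "finite_measure ?P"
    by (intro prob_space.finite_measure prob_space_distr) simp
  show fin: "finite_measure (density ?D ?d)"
  proof
    have "emeasure (density ?D ?d) (space (density ?D ?d)) = (\<integral>\<^sup>+p. ?d p * indicator (space ?D) p \<partial>?D)"
      unfolding space_density by (rule emeasure_density) (simp, rule sets.top)
    also have "\<dots> = (\<integral>\<^sup>+p. ?d p \<partial>?D)"
      by (rule nn_integral_cong) simp
    also have "\<dots> \<le> (\<integral>\<^sup>+p. 2 \<partial>?D)"
      by (rule nn_integral_mono)
        (use joint_factor_bounds[OF a b] in \<open>auto simp: ennreal_le_iff2 simp flip: ennreal_numeral\<close>)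
    also have "\<dots> = 2 * emeasure ?D (space ?D)" by simp
    also have "\<dots> < \<infinity>" using DXY.emeasure_space_1 by simp
    finally show "emeasure (density ?D ?d) (space (density ?D ?d)) \<noteq> \<infinity>" by simp
  qed
  show "measure ?P ({..x} \<times> {..y}) = measure (density ?D ?d) ({..x} \<times> {..y})" for x y
  proof -
    have "{..x} \<times> {..y} \<in> sets (borel \<Otimes>\<^sub>M borel :: (real \<times> real) measure)"
      by simp
    then have "measure ?P ({..x} \<times> {..y}) = F x * G y + \<theta> * \<phi> (F x) * \<phi> (G y)"
      unfolding prob_XY_le[symmetric]
      by (simp add: measure_distr vimage_def Int_def conj_commute)
    moreover have "measure (density ?D ?d) ({..x} \<times> {..y}) = F x * G y + \<theta> * (\<phi> (F x) * \<phi> (G y))"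
      using measure_density_rectangle[OF a b, of "{..x}" "{..y}"] a b
      by (simp add: margin_density_def cdf_def)
    ultimately show ?thesis by simp
  qed
qed

lemma margin_densities:
  obtains a b where "margin_density (distr M borel X) a" "margin_density (distr M borel Y) b"
proof -
  obtain a where "margin_density (distr M borel X) a"
    by (rule DX.lipschitz_cdf_density[of \<phi>, OF \<phi>0 \<phi>1 lip]) (auto simp: margin_density_def)
  moreover obtain b where "margin_density (distr M borel Y) b"
    by (rule DY.lipschitz_cdf_density[of \<phi>, OF \<phi>0 \<phi>1 lip]) (auto simp: margin_density_def)
  ultimately show thesis by (rule that)
qed

text \<open>With equal marginals one \<open>a\<close> serves both variables, and the covariance is
  \<theta> times the square of the integral of \<open>a g\<close>. Boundedness of \<open>a\<close>
  makes \<open>a g\<close> integrable, and with it g(X) g(Y).\<close>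

lemma PFD:
  assumes "F = G"
  shows "PFD M X Y"
  unfolding PFD_def
proof (intro ballI impI)
  fix g :: "real \<Rightarrow> real"
  assume [measurable]: "g \<in> borel_measurable borel"
    and int: "integrable M (\<lambda>\<omega>. g (X \<omega>))" "integrable M (\<lambda>\<omega>. g (Y \<omega>))"
  have D: "distr M borel Y = distr M borel X"
    using assms by (intro cdf_unique DX.real_distribution_axioms DY.real_distribution_axioms) simp
  obtain a where a: "margin_density (distr M borel X) a" using margin_densities by metis
  then have [measurable]: "a \<in> borel_measurable borel" by (simp add: margin_density_def)
  have bd: "\<bar>a x\<bar> \<le> 1" for x using a by (simp add: margin_density_def)
  have ge: "0 \<le> 1 + \<theta> * a x * a y" for x y using joint_factor_bounds[OF a a] by simp
  let ?D = "distr M borel X \<Otimes>\<^sub>M distr M borel Y"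
  have g: "integrable (distr M borel X) g" "integrable (distr M borel Y) g"
    using int by (simp_all add: integrable_distr_eq)
  have ga: "integrable (distr M borel X) (\<lambda>x. a x * g x)"
    by (rule Bochner_Integration.integrable_bound[OF g(1)]) (use bd in \<open>auto simp: abs_mult mult_left_le_one_le\<close>)
  have gb: "integrable (distr M borel Y) (\<lambda>x. a x * g x)" using ga D by simp
  have split: "(1 + \<theta> * a (fst p) * a (snd p)) *\<^sub>R (g (fst p) * g (snd p)) =
      (\<lambda>(x, y). g x * g y) p + \<theta> * (\<lambda>(x, y). (a x * g x) * (a y * g y)) p" for p
    by (simp add: case_prod_beta algebra_simps)
  note law = joint_law[OF a a[folded D]]
  note ints = DXY.integrable_pair_mult[OF g] DXY.integrable_pair_mult[OF ga gb]
  have meas: "(\<lambda>p. g (fst p) * g (snd p)) \<in> borel_measurable ?D"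
    "(\<lambda>p. 1 + \<theta> * a (fst p) * a (snd p)) \<in> borel_measurable ?D" by measurable
  have "integrable (distr M (borel \<Otimes>\<^sub>M borel) (\<lambda>\<omega>. (X \<omega>, Y \<omega>))) (\<lambda>p. g (fst p) * g (snd p))"
    unfolding law case_prod_beta
    by (subst integrable_density[OF meas])
      (use ints ge in \<open>simp_all only: split Bochner_Integration.integrable_add integrable_mult_right AE_I2\<close>)
  then have "integrable M (\<lambda>\<omega>. g (X \<omega>) * g (Y \<omega>))"
    by (simp add: integrable_distr_eq)
  moreover have "(\<integral>\<omega>. g (X \<omega>) * g (Y \<omega>) \<partial>M) = (\<integral>p. g (fst p) * g (snd p) \<partial>distr M (borel \<Otimes>\<^sub>M borel) (\<lambda>\<omega>. (X \<omega>, Y \<omega>)))"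
    by (simp add: integral_distr)
  moreover have "\<dots> = (\<integral>p. (1 + \<theta> * a (fst p) * a (snd p)) *\<^sub>R (g (fst p) * g (snd p)) \<partial>?D)"
    unfolding law case_prod_beta
    by (rule integral_density[OF meas]) (use ge in auto)
  moreover have "\<dots> = (LINT x|distr M borel X. g x) * (LINT x|distr M borel Y. g x)
      + \<theta> * ((LINT x|distr M borel X. a x * g x) * (LINT x|distr M borel Y. a x * g x))"
    unfolding split using DXY.integral_pair_mult[OF g] DXY.integral_pair_mult[OF ga gb]
    by (simp only: Bochner_Integration.integral_add[OF ints(1) integrable_mult_right[OF ints(2)]] integral_mult_right_zero)
  moreover have "0 \<le> \<theta> * ((LINT x|distr M borel X. a x * g x) * (LINT x|distr M borel Y. a x * g x))"
    using \<theta>_pos by (simp add: D)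
  ultimately show "integrable M (\<lambda>\<omega>. g (X \<omega>) * g (Y \<omega>)) \<and>
      0 \<le> (\<integral>\<omega>. g (X \<omega>) * g (Y \<omega>) \<partial>M) - (\<integral>\<omega>. g (X \<omega>) \<partial>M) * (\<integral>\<omega>. g (Y \<omega>) \<partial>M)"
    by (simp add: integral_distr)
qed

end

section \<open>Quadrant and tail dependence\<close>

lemma mono_on_extend_right:
  fixes f :: "real \<Rightarrow> real"
  assumes mono: "mono_on {a<..<b} f" and lim: "(f \<longlongrightarrow> f b) (at_left b)"
  shows "mono_on {a<..b} f"
proof (rule mono_onI)
  fix x y assume xy: "x \<in> {a<..b}" "y \<in> {a<..b}" "x \<le> y"
  show "f x \<le> f y"
  proof (cases "y = b \<and> x \<noteq> b")
    case True
    have "eventually (\<lambda>t. f x \<le> f t) (at_left b)"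
      by (rule eventually_at_leftI[of x]) (use mono xy True in \<open>auto simp: mono_on_def\<close>)
    then show ?thesis using tendsto_lowerbound[OF lim] True by simp
  qed (use mono xy in \<open>auto simp: mono_on_def\<close>)
qed

lemma antimono_on_uminus_iff:
  fixes f :: "real \<Rightarrow> real"
  shows "antimono_on A f \<longleftrightarrow> mono_on A (\<lambda>x. - f x)"
  by (simp add: monotone_on_def)

lemma mono_on_reflect_iff:
  fixes f :: "real \<Rightarrow> real"
  shows "mono_on {x. P x} f \<longleftrightarrow> antimono_on {x. P (- x)} (\<lambda>x. f (- x))"
proof
  assume *: "antimono_on {x. P (- x)} (\<lambda>x. f (- x))"
  show "mono_on {x. P x} f"
    by (rule mono_onI) (use monotone_onD[OF *, of "- y" "- x" for x y] in auto)
qed (auto simp: monotone_on_def)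

lemma all_reflect_iff: "(\<forall>x :: real. P x) \<longleftrightarrow> (\<forall>x. P (- x))"
  by (metis minus_minus)

lemma all3_reflect_iff:
  fixes A B :: "real \<Rightarrow> real \<Rightarrow> real \<Rightarrow> bool"
  shows "(\<forall>x y. (\<forall>z. A x y z) \<and> (\<forall>z. B x y z)) \<longleftrightarrow>
    (\<forall>x y. (\<forall>z. A (- x) (- y) (- z)) \<and> (\<forall>z. B (- x) (- y) (- z)))" (is "?L \<longleftrightarrow> ?R")
proof
  assume R: ?R
  have "A x y z \<and> B x y z" for x y z
    using R[rule_format, THEN conjunct1, rule_format, of "- x" "- y" "- z"]
      R[rule_format, THEN conjunct2, rule_format, of "- x" "- y" "- z"] by simp
  then show ?L by blast
qed blast

text \<open>The hypothesis \<open>tp\<close> is total positivity of order 2 of the joint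
  distribution function. If \<open>x \<le> s\<close> the numerator is fixed and only the denominator
  grows. Otherwise the passage from \<open>s\<close> to \<open>t\<close> is split at
  \<open>z = min x t\<close>: up to \<open>z\<close> the hypothesis applies, beyond it only the
  denominator grows.\<close>

lemma (in prob_space) left_corner_antimono_on:
  fixes X Y :: "'a \<Rightarrow> real"
  assumes [measurable]: "random_variable borel X" "random_variable borel Y"
    and tp: "\<And>x1 x2 y1 y2. x1 \<le> x2 \<Longrightarrow> y1 \<le> y2 \<Longrightarrow>
      prob {\<omega> \<in> space M. X \<omega> \<le> x2 \<and> Y \<omega> \<le> y1} * prob {\<omega> \<in> space M. X \<omega> \<le> x1 \<and> Y \<omega> \<le> y2}
      \<le> prob {\<omega> \<in> space M. X \<omega> \<le> x1 \<and> Y \<omega> \<le> y1} * prob {\<omega> \<in> space M. X \<omega> \<le> x2 \<and> Y \<omega> \<le> y2}"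
  shows "antimono_on {x'. \<P>(\<omega> in M. X \<omega> \<le> x' \<and> Y \<omega> \<le> y') > 0}
    (\<lambda>x'. \<P>(\<omega> in M. X \<omega> \<le> x \<and> Y \<omega> \<le> y \<bar> X \<omega> \<le> x' \<and> Y \<omega> \<le> y'))"
proof -
  define H where "H s t = prob {\<omega> \<in> space M. X \<omega> \<le> s \<and> Y \<omega> \<le> t}" for s t
  have H_mono: "H s t \<le> H s' t'" if "s \<le> s'" "t \<le> t'" for s s' t t'
    unfolding H_def by (rule finite_measure_mono) (use that in auto)
  have H_ge: "0 \<le> H s t" for s t by (simp add: H_def)
  have H_tp: "H x2 y1 * H x1 y2 \<le> H x1 y1 * H x2 y2" if "x1 \<le> x2" "y1 \<le> y2" for x1 x2 y1 y2
    unfolding H_def by (rule tp[OF that])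
  define m where "m = min y y'"
  have cond: "\<P>(\<omega> in M. X \<omega> \<le> x \<and> Y \<omega> \<le> y \<bar> X \<omega> \<le> x' \<and> Y \<omega> \<le> y') = H (min x x') m / H x' y'" for x'
    unfolding cond_prob_def H_def m_def
    by (intro arg_cong2[of _ _ _ _ "(/)"] arg_cong[of _ _ prob]) auto
  show ?thesis unfolding cond
  proof (rule monotone_onI, goal_cases)
    case (1 s t)
    then have s: "0 < H s y'" by (simp add: H_def)
    show "H (min x t) m / H t y' \<le> H (min x s) m / H s y'"
    proof (cases "x \<le> s")
      case True
      then show ?thesis using s 1 H_ge H_mono[of s t y' y'] by (auto simp: min_def intro!: divide_left_mono)
    next
      case False
      define z where "z = min x t"
      have z: "s \<le> z" "z \<le> t" using False 1 by (auto simp: z_def)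
      have zpos: "0 < H z y'" using s H_mono[OF z(1), of y' y'] by simp
      have "H z m / H t y' \<le> H z m / H z y'"
        using zpos H_ge H_mono[OF z(2), of y' y'] by (intro divide_left_mono) auto
      also have "\<dots> \<le> H s m / H s y'"
        using H_tp[OF z(1), of m y'] zpos s by (simp add: m_def field_simps)
      finally show ?thesis using False by (simp add: z_def)
    qed
  qed
qed

section \<open>Quadrants and left tails of the pair\<close>

context lipschitz_copula_pair
begin

lemma F_attains: "0 < u \<Longrightarrow> u < 1 \<Longrightarrow> \<exists>x. F x = u"
  by (rule DX.cdf_attains[OF cont_X]) auto

lemma G_attains: "0 < u \<Longrightarrow> u < 1 \<Longrightarrow> \<exists>y. G y = u"
  by (rule DY.cdf_attains[OF cont_Y]) auto

text \<open>The endpoints, which \<open>F\<close> and \<open>G\<close> may fail to attain, are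
  excluded by \<phi>(0) = \<phi>(1) = 0.\<close>

lemma nonzero_attained:
  assumes "u \<in> {0..1}" "\<phi> u \<noteq> 0"
  obtains x y where "F x = u" "G y = u"
proof -
  have "0 < u" "u < 1" using assms \<phi>0 \<phi>1 by (auto simp: less_le)
  then show thesis using F_attains G_attains that by metis
qed

text \<open>The excess over independence is \<theta> \<phi>(F(x)) \<phi>(G(y)). As \<open>x\<close>
  and \<open>y\<close> vary freely, a change of sign of \<phi> would make it negative
  somewhere.\<close>

lemma PQD_iff: "PQD M X Y \<longleftrightarrow> (\<forall>u\<in>{0..1}. 0 \<le> \<phi> u) \<or> (\<forall>u\<in>{0..1}. \<phi> u \<le> 0)"
proof -
  have "PQD M X Y \<longleftrightarrow> (\<forall>x y. 0 \<le> \<phi> (F x) * \<phi> (G y))"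
    unfolding PQD_def prob_XY_le prob_X_le prob_Y_le using \<theta>_pos
    by (simp add: mult.assoc zero_le_mult_iff)
  also have "\<dots> \<longleftrightarrow> (\<forall>u\<in>{0..1}. 0 \<le> \<phi> u) \<or> (\<forall>u\<in>{0..1}. \<phi> u \<le> 0)"
  proof
    assume *: "\<forall>x y. 0 \<le> \<phi> (F x) * \<phi> (G y)"
    show "(\<forall>u\<in>{0..1}. 0 \<le> \<phi> u) \<or> (\<forall>u\<in>{0..1}. \<phi> u \<le> 0)"
    proof (rule ccontr)
      assume "\<not> ?thesis"
      then obtain u v where uv: "u \<in> {0..1}" "\<phi> u < 0" "v \<in> {0..1}" "0 < \<phi> v" by (auto simp: not_le)
      obtain x where "F x = u" using nonzero_attained[of u] uv by auto
      moreover obtain y where "G y = v" using nonzero_attained[of v] uv by auto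
      ultimately show False using *[rule_format, of x y] uv by (simp add: zero_le_mult_iff)
    qed
  next
    assume "(\<forall>u\<in>{0..1}. 0 \<le> \<phi> u) \<or> (\<forall>u\<in>{0..1}. \<phi> u \<le> 0)"
    then show "\<forall>x y. 0 \<le> \<phi> (F x) * \<phi> (G y)"
      using F01 G01 by (auto simp: zero_le_mult_iff)
  qed
  finally show ?thesis .
qed

lemma cond_prob_le:
  assumes "0 < F x"
  shows "\<P>(\<omega> in M. Y \<omega> \<le> y \<bar> X \<omega> \<le> x) = G y + \<theta> * \<phi> (G y) * (\<phi> (F x) / F x)"
proof -
  have "\<P>(\<omega> in M. Y \<omega> \<le> y \<bar> X \<omega> \<le> x) = (F x * G y + \<theta> * \<phi> (F x) * \<phi> (G y)) / F x"
    unfolding cond_prob_def prob_X_le prob_XY_le[symmetric] by (simp only: conj_commute)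
  then show ?thesis using assms by (simp add: field_simps)
qed

text \<open>\<open>F\<close> may stay below 1, so LTD controls the quotient only on the open
  interval; continuity of \<phi> supplies the endpoint 1. The factor \<open>c\<close> is used with
  the values 1 and -1 for the two directions.\<close>

lemma ratio_mono_on_extend:
  assumes "mono_on {0<..<1} (\<lambda>u. c * (\<phi> u / u))"
  shows "mono_on {0<..1} (\<lambda>u. c * (\<phi> u / u))"
proof (rule mono_on_extend_right[OF assms])
  have "(\<phi> \<longlongrightarrow> \<phi> 1) (at_left 1)"
  proof (rule continuous_on_tendsto_compose[OF continuous_\<phi>, of "\<lambda>u. u"])
    show "eventually (\<lambda>u. u \<in> {0..1::real}) (at_left 1)"
      by (rule eventually_at_leftI[of 0]) auto
  qed auto
  then show "((\<lambda>u. c * (\<phi> u / u)) \<longlongrightarrow> c * (\<phi> 1 / 1)) (at_left 1)"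
    by (intro tendsto_intros) auto
qed

text \<open>For fixed \<open>y\<close> the conditional probability is affine in \<phi>(u) / u at u =
  F(x), with slope \<theta> \<phi>(G(y)). A single \<open>y\<close> with nonzero slope forces the
  quotient to be monotone, in the direction opposite to the sign of the slope.\<close>

lemma LTD_iff: "LTD M X Y \<longleftrightarrow> monotone_fun_on {0<..1} (\<lambda>u. \<phi> u / u)"
proof
  let ?q = "\<lambda>u. \<phi> u / u"
  assume LTD: "LTD M X Y"
  show "monotone_fun_on {0<..1} ?q"
  proof (cases "\<exists>v\<in>{0..1}. \<phi> v \<noteq> 0")
    case True
    then obtain v where v0: "v \<in> {0..1}" "\<phi> v \<noteq> 0" by auto
    from v0 obtain y where "G y = v" by (rule nonzero_attained)
    note v = v0(2) this
    have le: "\<phi> v * ?q t \<le> \<phi> v * ?q s" if st: "s \<in> {0<..<1}" "t \<in> {0<..<1}" "s < t" for s t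
    proof -
      obtain x where xs: "F x = s" using F_attains[of s] st by auto
      obtain x' where xt: "F x' = t" using F_attains[of t] st by auto
      note x = xs xt
      have "x \<le> x'" using DX.cdf_nondecreasing[of x' x] x st by linarith
      then have "\<P>(\<omega> in M. Y \<omega> \<le> y \<bar> X \<omega> \<le> x') \<le> \<P>(\<omega> in M. Y \<omega> \<le> y \<bar> X \<omega> \<le> x)"
        using LTD x that unfolding LTD_def prob_X_le by (auto simp: monotone_on_def)
      then have "\<theta> * (\<phi> v * ?q t) \<le> \<theta> * (\<phi> v * ?q s)"
        using x v that by (simp add: cond_prob_le mult.assoc)
      then show ?thesis by (rule mult_left_le_imp_le) (rule \<theta>_pos)
    qed
    show ?thesis
    proof (cases "0 < \<phi> v")
      case True
      have "mono_on {0<..<1} (\<lambda>u. -1 * ?q u)"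
      proof (rule mono_onI, goal_cases)
        case (1 s t)
        have "?q t \<le> ?q s" if "s \<noteq> t"
          by (rule mult_left_le_imp_le[OF le True]) (use 1 that in auto)
        then show ?case by (cases "s = t") auto
      qed
      from ratio_mono_on_extend[OF this] show ?thesis by (simp add: antimono_on_uminus_iff)
    next
      case False
      then have neg: "\<phi> v < 0" using v by simp
      have "mono_on {0<..<1} (\<lambda>u. 1 * ?q u)"
      proof (rule mono_onI, goal_cases)
        case (1 s t)
        have "?q s \<le> ?q t" if "s \<noteq> t"
        proof (rule mult_left_le_imp_le)
          show "- \<phi> v * ?q s \<le> - \<phi> v * ?q t"
            unfolding mult_minus_left neg_le_iff_le by (rule le) (use 1 that in auto)
        qed (use neg in simp)
        then show ?case by (cases "s = t") auto
      qed
      from ratio_mono_on_extend[OF this] show ?thesis by simp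
    qed
  qed (auto simp: monotone_on_def)
next
  let ?q = "\<lambda>u. \<phi> u / u"
  assume q: "monotone_fun_on {0<..1} ?q"
  \<comment> \<open>A nondecreasing quotient ending in \<open>?q 1 = 0\<close> is nonpositive, a
    nonincreasing one nonnegative. Hence the sign of \<phi>(G(y)) always turns the product into a
    nonincreasing function.\<close>
  have le: "\<phi> (G y) * ?q t \<le> \<phi> (G y) * ?q s" if "0 < s" "s \<le> t" "t \<le> 1" for s t y
    using q
  proof
    assume "mono_on {0<..1} ?q"
    then have "?q s \<le> ?q t" "G y > 0 \<Longrightarrow> ?q (G y) \<le> ?q 1"
      using that G01[of y] by (auto simp: mono_on_def simp del: div_by_1)
    moreover from this have "\<phi> (G y) \<le> 0" using G01[of y] by (cases "G y = 0") (auto simp: \<phi>0 \<phi>1 divide_le_0_iff)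
    ultimately show ?thesis by (intro mult_left_mono_neg)
  next
    assume "antimono_on {0<..1} ?q"
    then have "?q t \<le> ?q s" "G y > 0 \<Longrightarrow> ?q 1 \<le> ?q (G y)"
      using that G01[of y] by (auto simp: monotone_on_def simp del: div_by_1)
    moreover from this have "0 \<le> \<phi> (G y)" using G01[of y] by (cases "G y = 0") (auto simp: \<phi>0 \<phi>1 zero_le_divide_iff)
    ultimately show ?thesis by (intro mult_left_mono)
  qed
  have "\<theta> * (\<phi> (G y) * ?q t) \<le> \<theta> * (\<phi> (G y) * ?q s)" if "0 < s" "s \<le> t" "t \<le> 1" for s t y
    by (rule mult_left_mono[OF le[OF that] less_imp_le[OF \<theta>_pos]])
  then show "LTD M X Y"
    unfolding LTD_def prob_X_le monotone_on_def
    using F01 DX.cdf_nondecreasing by (auto simp: cond_prob_le mult.assoc less_le_trans)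
qed

text \<open>With q(u) = \<phi>(u) / u the two sides differ by a nonnegative multiple of the product
  of the increments of \<open>q\<close> along \<open>F\<close> and along \<open>G\<close>; the terms
  quadratic in \<theta> cancel. Both increments have the same sign because it is the same monotone
  \<open>q\<close>.\<close>

lemma prob_XY_le_tp2:
  assumes q: "monotone_fun_on {0<..1} (\<lambda>u. \<phi> u / u)" and "x1 \<le> x2" "y1 \<le> y2"
  shows "prob {\<omega> \<in> space M. X \<omega> \<le> x2 \<and> Y \<omega> \<le> y1} * prob {\<omega> \<in> space M. X \<omega> \<le> x1 \<and> Y \<omega> \<le> y2}
      \<le> prob {\<omega> \<in> space M. X \<omega> \<le> x1 \<and> Y \<omega> \<le> y1} * prob {\<omega> \<in> space M. X \<omega> \<le> x2 \<and> Y \<omega> \<le> y2}"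
proof (cases "0 < F x1 \<and> 0 < G y1")
  case False
  then show ?thesis using F01[of x1] G01[of y1] by (auto simp: prob_XY_le \<phi>0 not_less dest!: antisym)
next
  case True
  define q where "q u = \<phi> u / u" for u
  have H: "prob {\<omega> \<in> space M. X \<omega> \<le> x \<and> Y \<omega> \<le> y} = F x * G y * (1 + \<theta> * (q (F x) * q (G y)))"
    if "0 < F x" "0 < G y" for x y
    using that by (simp add: prob_XY_le q_def algebra_simps)
  have le: "F x1 \<le> F x2" "G y1 \<le> G y2"
    using assms by (simp_all add: DX.cdf_nondecreasing DY.cdf_nondecreasing)
  then have pos: "0 < F x2" "0 < G y2" using True by simp_all
  have "0 \<le> (q (F x2) - q (F x1)) * (q (G y2) - q (G y1))"
    using q le pos True F01 G01 by (auto simp: q_def[symmetric] monotone_on_def zero_le_mult_iff)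
  moreover have "0 \<le> F x1 * G y1 * F x2 * G y2 * \<theta>"
    using \<theta>_pos pos True by simp
  ultimately have "0 \<le> F x1 * G y1 * F x2 * G y2 * \<theta> * ((q (F x2) - q (F x1)) * (q (G y2) - q (G y1)))"
    by (rule mult_nonneg_nonneg[rotated])
  then show ?thesis unfolding H[OF pos] using True pos by (simp add: H algebra_simps)
qed

lemma LCSD_iff: "LCSD M X Y \<longleftrightarrow> LTD M X Y"
proof
  interpret swap: lipschitz_copula_pair M Y X \<phi> \<theta> by (rule swapped)
  assume "LTD M X Y"
  then have q: "monotone_fun_on {0<..1} (\<lambda>u. \<phi> u / u)" by (simp add: LTD_iff)
  show "LCSD M X Y"
    unfolding LCSD_def
    using left_corner_antimono_on[OF rv_X rv_Y prob_XY_le_tp2[OF q]]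
      left_corner_antimono_on[OF rv_Y rv_X swap.prob_XY_le_tp2[OF q]]
    by (simp add: conj_commute)
next
  assume LCSD: "LCSD M X Y"
  define H where "H s t = prob {\<omega> \<in> space M. X \<omega> \<le> s \<and> Y \<omega> \<le> t}" for s t
  have lim: "((\<lambda>t. H s t) \<longlongrightarrow> F s) at_top" for s
  proof -
    have "((\<lambda>t. F s * G t + \<theta> * \<phi> (F s) * \<phi> (G t)) \<longlongrightarrow> F s * 1 + \<theta> * \<phi> (F s) * \<phi> 1) at_top"
      by (intro tendsto_intros continuous_on_tendsto_compose[OF continuous_\<phi>] DY.cdf_lim_at_top_prob)
        (use G01 in auto)
    then show ?thesis by (simp add: H_def prob_XY_le \<phi>1)
  qed
  have cond: "\<P>(\<omega> in M. Y \<omega> \<le> y \<bar> X \<omega> \<le> x) = H x y / F x" for x y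
    unfolding cond_prob_def prob_X_le H_def by (simp only: conj_commute)
  show "LTD M X Y"
    unfolding LTD_def cond prob_X_le
  proof (intro allI monotone_onI, goal_cases)
    case (1 y s t)
    then have s: "0 < F s" "s \<le> t" by auto
    then have t: "0 < F t" using DX.cdf_nondecreasing[of s t] by simp
    \<comment> \<open>Letting \<open>y'\<close> tend to infinity removes the condition on
      \<open>Y\<close>. Once \<open>y' \<ge> y\<close>, intersecting the corner at
      \<open>(t, y)\<close> with the corner at \<open>(z, y')\<close> for \<open>z \<le> t\<close>
      leaves the corner at \<open>(z, y)\<close>, so LCSD compares the quotients
      \<open>H z y / H z y'\<close> at \<open>z = s\<close> and \<open>z = t\<close>.\<close>
    have ev: "eventually (\<lambda>y'. H t y / H t y' \<le> H s y / H s y') at_top"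
      using eventually_ge_at_top[of y] order_tendstoD(1)[OF lim s(1)] order_tendstoD(1)[OF lim t]
    proof eventually_elim
      case (elim y')
      have "\<P>(\<omega> in M. X \<omega> \<le> t \<and> Y \<omega> \<le> y \<bar> X \<omega> \<le> z \<and> Y \<omega> \<le> y') = H z y / H z y'" if "z \<le> t" for z
        unfolding cond_prob_def H_def
        by (intro arg_cong2[of _ _ _ _ "(/)"] arg_cong[of _ _ prob]) (use elim that in auto)
      moreover have "\<P>(\<omega> in M. X \<omega> \<le> t \<and> Y \<omega> \<le> y \<bar> X \<omega> \<le> t \<and> Y \<omega> \<le> y')
          \<le> \<P>(\<omega> in M. X \<omega> \<le> t \<and> Y \<omega> \<le> y \<bar> X \<omega> \<le> s \<and> Y \<omega> \<le> y')"
        using LCSD[unfolded LCSD_def, rule_format, THEN conjunct1, rule_format, of y' t y] elim s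
        by (auto simp: monotone_on_def H_def)
      ultimately show ?case using s by simp
    qed
    show "H t y / F t \<le> H s y / F s"
      by (rule tendsto_le[OF _ _ _ ev]) (use s t in \<open>auto intro!: tendsto_intros lim\<close>)
  qed
qed

section \<open>Right tails by reflection\<close>

lemma AE_X_neq: "AE \<omega> in M. X \<omega> \<noteq> x"
proof -
  have "prob {\<omega> \<in> space M. X \<omega> = x} = 0"
    using cont_X[of x] by (simp add: DX.isCont_cdf measure_distr vimage_def Int_def conj_commute)
  then show ?thesis by (subst (asm) prob_eq_0) auto
qed

lemma prob_X_gt: "prob {\<omega> \<in> space M. X \<omega> > x} = 1 - F x"
  using prob_neg[of "\<lambda>\<omega>. X \<omega> \<le> x"] by (simp add: prob_X_le not_le)

text \<open>Inclusion and exclusion turns \<open>F G\<close> into \<open>(1 - F) (1 - G)\<close> but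
  leaves the perturbation as it is; hence the reflected pair has a copula of the same
  family.\<close>

lemma prob_XY_gt: "prob {\<omega> \<in> space M. X \<omega> > x \<and> Y \<omega> > y} =
    (1 - F x) * (1 - G y) + \<theta> * \<phi> (F x) * \<phi> (G y)"
proof -
  have "prob {\<omega> \<in> space M. X \<omega> \<le> x} = prob ({\<omega> \<in> space M. X \<omega> \<le> x \<and> Y \<omega> \<le> y} \<union> {\<omega> \<in> space M. X \<omega> \<le> x \<and> Y \<omega> > y})"
    by (rule arg_cong[of _ _ prob]) auto
  also have "\<dots> = prob {\<omega> \<in> space M. X \<omega> \<le> x \<and> Y \<omega> \<le> y} + prob {\<omega> \<in> space M. X \<omega> \<le> x \<and> Y \<omega> > y}"
    by (rule finite_measure_Union) auto
  finally have 1: "F x = F x * G y + \<theta> * \<phi> (F x) * \<phi> (G y) + prob {\<omega> \<in> space M. X \<omega> \<le> x \<and> Y \<omega> > y}"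
    by (simp add: prob_X_le prob_XY_le)
  have "prob {\<omega> \<in> space M. Y \<omega> > y} = prob ({\<omega> \<in> space M. X \<omega> \<le> x \<and> Y \<omega> > y} \<union> {\<omega> \<in> space M. X \<omega> > x \<and> Y \<omega> > y})"
    by (rule arg_cong[of _ _ prob]) auto
  also have "\<dots> = prob {\<omega> \<in> space M. X \<omega> \<le> x \<and> Y \<omega> > y} + prob {\<omega> \<in> space M. X \<omega> > x \<and> Y \<omega> > y}"
    by (rule finite_measure_Union) auto
  also have "prob {\<omega> \<in> space M. Y \<omega> > y} = 1 - G y"
    using prob_neg[of "\<lambda>\<omega>. Y \<omega> \<le> y"] by (simp add: prob_Y_le not_le)
  finally show ?thesis using 1 by (simp add: algebra_simps)
qed

lemma AE_Y_neq: "AE \<omega> in M. Y \<omega> \<noteq> y"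
  by (rule lipschitz_copula_pair.AE_X_neq[OF swapped])

text \<open>The event - X \<le> x is X \<ge> - x; it differs from the strict inequality by a single
  value, which has probability 0 as the distribution functions are continuous.\<close>

lemma AE_reflect: "AE \<omega> in M. (- X \<omega> \<le> x \<longleftrightarrow> X \<omega> > - x) \<and> (- Y \<omega> \<le> y \<longleftrightarrow> Y \<omega> > - y)"
  using AE_X_neq[of "- x"] AE_Y_neq[of "- y"] by eventually_elim auto

lemma prob_reflect:
  "prob {\<omega> \<in> space M. - X \<omega> \<le> x} = prob {\<omega> \<in> space M. X \<omega> > - x}"
  "prob {\<omega> \<in> space M. - X \<omega> \<le> x \<and> - Y \<omega> \<le> y} = prob {\<omega> \<in> space M. X \<omega> > - x \<and> Y \<omega> > - y}"
  by (auto intro!: finite_measure_eq_AE intro: eventually_mono[OF AE_reflect[of x y]])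

lemma cdf_reflect: "cdf (distr M borel (\<lambda>\<omega>. - X \<omega>)) x = 1 - F (- x)"
proof -
  have "cdf (distr M borel (\<lambda>\<omega>. - X \<omega>)) x = prob {\<omega> \<in> space M. - X \<omega> \<le> x}"
    by (simp add: cdf_def measure_distr vimage_def Int_def conj_commute)
  then show ?thesis by (simp only: prob_reflect prob_X_gt)
qed

text \<open>At u = 1 - F(- x), the distribution function of - X, the value \<phi>(1 - u) is
  \<phi>(F(- x)), as the formula \<open>prob_XY_gt\<close> for the upper corner requires.\<close>

lemma reflected: "lipschitz_copula_pair M (\<lambda>\<omega>. - X \<omega>) (\<lambda>\<omega>. - Y \<omega>) (\<lambda>u. \<phi> (1 - u)) \<theta>"
proof -
  interpret swap: lipschitz_copula_pair M Y X \<phi> \<theta> by (rule swapped)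
  have [simp]: "cdf (distr M borel (\<lambda>\<omega>. - X \<omega>)) = (\<lambda>x. 1 - F (- x))"
      "cdf (distr M borel (\<lambda>\<omega>. - Y \<omega>)) = (\<lambda>x. 1 - G (- x))"
    using cdf_reflect swap.cdf_reflect by auto
  have "isCont (\<lambda>x. 1 - F (- x)) x" "isCont (\<lambda>x. 1 - G (- x)) x" for x
    by (intro continuous_intros isCont_o2[OF _ cont_X] isCont_o2[OF _ cont_Y])+
  moreover have "\<bar>\<phi> (1 - x) - \<phi> (1 - y)\<bar> \<le> \<bar>x - y\<bar>" if "x \<in> {0..1}" "y \<in> {0..1}" for x y
    using lip[of "1 - x" "1 - y"] that by auto
  ultimately show ?thesis
    by unfold_locales
      (auto simp: \<phi>0 \<phi>1 \<theta>_pos \<theta>_le has_copula_def copula_family_def prob_reflect prob_XY_gt)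
qed

lemma RTI_reflect: "RTI M X Y \<longleftrightarrow> LTD M (\<lambda>\<omega>. - X \<omega>) (\<lambda>\<omega>. - Y \<omega>)"
proof -
  have "\<P>(\<omega> in M. - Y \<omega> \<le> y \<bar> - X \<omega> \<le> x) = \<P>(\<omega> in M. Y \<omega> > - y \<bar> X \<omega> > - x)" for x y
    using prob_reflect(2)[of x y] prob_reflect(1)[of x] by (simp add: cond_prob_def conj_commute)
  then show ?thesis
    unfolding RTI_def LTD_def
    by (subst all_reflect_iff, subst mono_on_reflect_iff) (simp add: prob_reflect(1))
qed

lemma RCSI_reflect: "RCSI M X Y \<longleftrightarrow> LCSD M (\<lambda>\<omega>. - X \<omega>) (\<lambda>\<omega>. - Y \<omega>)"
proof -
  have "prob {\<omega> \<in> space M. (- X \<omega> \<le> x \<and> - Y \<omega> \<le> y) \<and> (- X \<omega> \<le> x' \<and> - Y \<omega> \<le> y')} =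
      prob {\<omega> \<in> space M. (X \<omega> > - x \<and> Y \<omega> > - y) \<and> (X \<omega> > - x' \<and> Y \<omega> > - y')}" for x y x' y'
    by (auto intro!: finite_measure_eq_AE intro: eventually_elim2[OF AE_reflect[of x y] AE_reflect[of x' y']])
  then have cond: "\<P>(\<omega> in M. - X \<omega> \<le> x \<and> - Y \<omega> \<le> y \<bar> - X \<omega> \<le> x' \<and> - Y \<omega> \<le> y') =
      \<P>(\<omega> in M. X \<omega> > - x \<and> Y \<omega> > - y \<bar> X \<omega> > - x' \<and> Y \<omega> > - y')" for x y x' y'
    by (simp only: cond_prob_def prob_reflect(2))
  show ?thesis
    unfolding RCSI_def LCSD_def cond prob_reflect(2) mono_on_reflect_iff
    by (rule all3_reflect_iff)
qed

lemma RTI_iff: "RTI M X Y \<longleftrightarrow> monotone_fun_on {0..<1} (\<lambda>u. \<phi> u / (u - 1))"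
proof -
  have "RTI M X Y \<longleftrightarrow> monotone_fun_on {0<..1} (\<lambda>u. \<phi> (1 - u) / u)"
    unfolding RTI_reflect by (rule lipschitz_copula_pair.LTD_iff[OF reflected])
  also have "\<dots> \<longleftrightarrow> monotone_fun_on {0..<1} (\<lambda>u. \<phi> u / (u - 1))"
  proof -
    \<comment> \<open>Replacing u by 1 - u reverses the order, and passing from the denominator u to
      (1 - u) - 1 = - u changes the sign. The two reversals cancel, so each direction of
      monotonicity is kept; \<open>R\<close> covers both directions.\<close>
    have "monotone_on {0<..1} (\<le>) (\<lambda>p q. R (- q) (- p)) (\<lambda>u. \<phi> (1 - u) / u) \<longleftrightarrow>
        monotone_on {0..<1} (\<le>) R (\<lambda>u. \<phi> u / (u - 1))" for R :: "real \<Rightarrow> real \<Rightarrow> bool"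
    proof -
      have eq: "- (\<phi> (1 - u) / u) = \<phi> (1 - u) / ((1 - u) - 1)" for u by simp
      show ?thesis
        unfolding monotone_on_def eq
      proof (intro iffI ballI impI, goal_cases)
        case (1 s t)
        then show ?case using 1(1)[rule_format, of "1 - t" "1 - s"] by simp
      next
        case (2 s t)
        then show ?case using 2(1)[rule_format, of "1 - t" "1 - s"] by simp
      qed
    qed
    from this[of "(\<le>)"] this[of "(\<ge>)"] show ?thesis by simp
  qed
  finally show ?thesis .
qed

lemma RCSI_iff: "RCSI M X Y \<longleftrightarrow> RTI M X Y"
  unfolding RCSI_reflect RTI_reflect by (rule lipschitz_copula_pair.LCSD_iff[OF reflected])

end

section \<open>Stochastic monotonicity and total positivity\<close>

text \<open>The sigma-algebra generated by \<open>X\<close> consists of preimages of Borel sets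
  \<open>B\<close>, so the defining identity of the conditional expectation is a statement about
  integrals over \<open>B\<close> against the law of \<open>X\<close>.\<close>

lemma (in prob_space) real_cond_exp_indicator_eq:
  fixes X :: "'a \<Rightarrow> real" and p :: "real \<Rightarrow> real"
  assumes [measurable]: "random_variable borel X" "E \<in> events" "p \<in> borel_measurable borel"
    and int: "integrable (distr M borel X) p"
    and eq: "\<And>B. B \<in> sets borel \<Longrightarrow>
      prob {\<omega> \<in> space M. X \<omega> \<in> B \<and> \<omega> \<in> E} = (LINT x|distr M borel X. indicator B x * p x)"
  shows "AE \<omega> in M. real_cond_exp M (vimage_algebra (space M) X borel) (indicator E) \<omega> = p (X \<omega>)"
proof -
  let ?F = "vimage_algebra (space M) X borel"
  interpret finite_measure_subalgebra M ?F
  proof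
    show "subalgebra M ?F"
      by (auto simp: subalgebra_def sets_vimage_algebra2)
  qed
  show ?thesis
  proof (rule real_cond_exp_charact)
    fix A assume "A \<in> sets ?F"
    then obtain B where [measurable]: "B \<in> sets borel" and A: "A = X -` B \<inter> space M"
      by (auto simp: sets_vimage_algebra2)
    have "(\<integral>\<omega>\<in>A. indicator E \<omega> \<partial>M) = (\<integral>\<omega>. indicator {\<omega> \<in> space M. X \<omega> \<in> B \<and> \<omega> \<in> E} \<omega> \<partial>M)"
      unfolding set_lebesgue_integral_def A
      by (rule Bochner_Integration.integral_cong) (auto simp: indicator_def)
    also have "\<dots> = (LINT x|distr M borel X. indicator B x * p x)"
      by (simp add: eq)
    also have "\<dots> = (\<integral>\<omega>\<in>A. p (X \<omega>) \<partial>M)"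
      unfolding set_lebesgue_integral_def A
      by (subst integral_distr) (auto intro!: Bochner_Integration.integral_cong simp: indicator_def)
    finally show "(\<integral>\<omega>\<in>A. indicator E \<omega> \<partial>M) = (\<integral>\<omega>\<in>A. p (X \<omega>) \<partial>M)" .
  next
    show "integrable M (\<lambda>\<omega>. p (X \<omega>))" using int by (simp add: integrable_distr_eq)
    show "(\<lambda>\<omega>. p (X \<omega>)) \<in> borel_measurable ?F"
      by (rule measurable_compose[OF measurable_vimage_algebra1]) auto
    show "integrable M (indicator E :: 'a \<Rightarrow> real)"
      by (rule integrable_real_indicator) (auto simp: less_top[symmetric])
  qed
qed

text \<open>SI demands a version monotone on the whole line, while conditional probabilities are
  controlled only on a set \<open>S\<close> carrying the law. The extension is the supremum of the
  values to the left; the inserted 0 covers the points left of \<open>S\<close> and changes nothing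
  on \<open>S\<close>, where \<open>f\<close> is nonnegative.\<close>

lemma bounded_mono_on_extend:
  fixes f :: "real \<Rightarrow> real"
  assumes mono: "mono_on S f" and bd: "\<And>x. x \<in> S \<Longrightarrow> 0 \<le> f x \<and> f x \<le> c"
  obtains g where "mono g" "\<And>x. x \<in> S \<Longrightarrow> g x = f x"
proof
  define g where "g x = Sup (insert 0 (f ` (S \<inter> {..x})))" for x
  have bdd: "bdd_above (insert 0 (f ` (S \<inter> {..x})))" for x
    using bd by (auto intro!: bdd_aboveI[of _ "max 0 c"] simp: le_max_iff_disj)
  show "mono g"
    unfolding g_def by (intro monoI cSup_subset_mono bdd) auto
  show "g x = f x" if "x \<in> S" for x
    unfolding g_def by (rule cSup_eq_maximum) (use that bd mono in \<open>auto simp: mono_on_def\<close>)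
qed

text \<open>The pointwise inequality at \<open>x1 \<le> x2\<close> and \<open>s \<le> y < t\<close>
  is integrated over all such \<open>s\<close> and \<open>t\<close>, each product of integrals being
  written as a double integral.\<close>

lemma TP2_integrated:
  assumes tp: "TP2 h" and nonneg: "\<And>p. 0 \<le> h p" and [measurable]: "h \<in> borel_measurable borel" and "x1 \<le> x2"
  shows "(\<integral>\<^sup>+t\<in>{y<..}. ennreal (h (x1, t)) \<partial>lborel) * (\<integral>\<^sup>+s\<in>{..y}. ennreal (h (x2, s)) \<partial>lborel)
    \<le> (\<integral>\<^sup>+t\<in>{y<..}. ennreal (h (x2, t)) \<partial>lborel) * (\<integral>\<^sup>+s\<in>{..y}. ennreal (h (x1, s)) \<partial>lborel)"
proof -
  have [measurable]: "(\<lambda>t. h (x, t)) \<in> borel_measurable borel" for x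
    by (rule measurable_compose[OF _ assms(3)]) (simp add: borel_prod[symmetric])
  have prod: "(\<integral>\<^sup>+t\<in>{y<..}. ennreal (h (u, t)) \<partial>lborel) * (\<integral>\<^sup>+s\<in>{..y}. ennreal (h (v, s)) \<partial>lborel) =
      (\<integral>\<^sup>+t. \<integral>\<^sup>+s. (ennreal (h (u, t)) * indicator {y<..} t) * (ennreal (h (v, s)) * indicator {..y} s) \<partial>lborel \<partial>lborel)"
    for u v by (simp add: nn_integral_cmult nn_integral_multc)
  show ?thesis
    unfolding prod
  proof (intro nn_integral_mono)
    fix t s :: real
    have "h (x1, t) * h (x2, s) \<le> h (x2, t) * h (x1, s)" if "s \<le> y" "y < t"
      using tp[unfolded TP2_def, rule_format, OF \<open>x1 \<le> x2\<close>, of s t] that by (simp add: mult.commute)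
    then show "ennreal (h (x1, t)) * indicator {y<..} t * (ennreal (h (x2, s)) * indicator {..y} s)
        \<le> ennreal (h (x2, t)) * indicator {y<..} t * (ennreal (h (x1, s)) * indicator {..y} s)"
      using nonneg by (auto simp: indicator_def simp flip: ennreal_mult intro!: ennreal_leI)
  qed
qed

section \<open>Consequences of a joint density\<close>

context prob_space
begin

lemma joint_density_marginal:
  assumes "joint_density M X Y h"
  shows "distributed M lborel X (\<lambda>x. \<integral>\<^sup>+y. ennreal (h (x, y)) \<partial>lborel)"
    and "distributed M lborel Y (\<lambda>y. \<integral>\<^sup>+x. ennreal (h (x, y)) \<partial>lborel)"
proof -
  have "distributed M (lborel \<Otimes>\<^sub>M lborel) (\<lambda>\<omega>. (X \<omega>, Y \<omega>)) (\<lambda>p. ennreal (h p))"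
    using assms by (simp add: joint_density_def lborel_prod)
  then show "distributed M lborel X (\<lambda>x. \<integral>\<^sup>+y. ennreal (h (x, y)) \<partial>lborel)"
    "distributed M lborel Y (\<lambda>y. \<integral>\<^sup>+x. ennreal (h (x, y)) \<partial>lborel)"
    by (auto intro: distr_marginal1 distr_marginal2 lborel.sigma_finite_measure_axioms)
qed

lemma distr_eq_density:
  fixes X :: "'a \<Rightarrow> real"
  assumes "distributed M lborel X f"
  shows "distr M borel X = density lborel f"
  using distributed_distr_eq_density[OF assms] by (metis distr_cong sets_lborel)

lemma continuous_cdf_if_distributed:
  fixes X :: "'a \<Rightarrow> real"
  assumes "distributed M lborel X f"
  shows "isCont (cdf (distr M borel X)) x"
proof -
  have X: "random_variable borel X" and [measurable]: "f \<in> borel_measurable borel"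
    using assms by (simp_all add: distributed_def)
  interpret D: real_distribution "distr M borel X" using X by simp
  have "emeasure (density lborel f) {x} = (\<integral>\<^sup>+t. f t * indicator {x} t \<partial>lborel)"
    by (simp add: emeasure_density)
  also have "\<dots> = 0" by (simp add: nn_integral_indicator_singleton)
  finally have "measure (distr M borel X) {x} = 0"
    by (simp add: distr_eq_density[OF assms] measure_def)
  then show ?thesis by (simp only: D.isCont_cdf)
qed

lemma AE_density_finite:
  assumes "distributed M lborel X f"
  shows "AE x in lborel. f x \<noteq> \<infinity>"
proof (rule nn_integral_noteq_infinite)
  have [measurable]: "f \<in> borel_measurable lborel" "X \<in> measurable M lborel"
    using assms by (simp_all only: distributed_def)
  then show "f \<in> borel_measurable lborel" by simp
  have "(\<integral>\<^sup>+x. f x \<partial>lborel) = emeasure (density lborel f) UNIV"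
    by (simp add: emeasure_density)
  also have "\<dots> = emeasure M (space M)"
    unfolding distributed_distr_eq_density[OF assms, symmetric]
    using distributed_measurable[OF assms] by (subst emeasure_distr) simp_all
  finally show "(\<integral>\<^sup>+x. f x \<partial>lborel) \<noteq> \<infinity>" by simp
qed

text \<open>Given X = x, the probability of Y > y is N / (N + L), where \<open>N\<close> and
  \<open>L\<close> are the integrals of the density over the parts of the vertical line at
  \<open>x\<close> above \<open>y\<close> and up to \<open>y\<close>. The integrated inequality
  N(x1) L(x2) \<le> N(x2) L(x1) says that this quotient is nondecreasing.\<close>

lemma SI_if_TP2_density:
  fixes X Y :: "'a \<Rightarrow> real"
  assumes dens: "joint_density M X Y h" and tp: "TP2_density h"
  shows "SI M X Y"
proof -
  obtain k where [measurable]: "k \<in> borel_measurable borel" and k: "\<And>p. 0 \<le> k p" "AE p in lborel. k p = h p" "TP2 k"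
    using tp by (auto simp: TP2_density_def)
  have joint: "distributed M lborel (\<lambda>\<omega>. (X \<omega>, Y \<omega>)) (\<lambda>p. ennreal (k p))"
  proof -
    have "distr M lborel (\<lambda>\<omega>. (X \<omega>, Y \<omega>)) = density lborel (\<lambda>p. ennreal (h p))"
      using dens by (simp add: joint_density_def distributed_def)
    also have "\<dots> = density lborel (\<lambda>p. ennreal (k p))"
      using dens k(2) by (intro density_cong) (auto simp: joint_density_def distributed_def)
    finally show ?thesis using dens by (simp add: joint_density_def distributed_def)
  qed
  then have dens_k: "joint_density M X Y k" using k(1) by (simp add: joint_density_def)
  have [measurable]: "random_variable borel X" "random_variable borel Y"
    using joint_density_marginal[OF dens] by (simp_all add: distributed_def)
  have [measurable]: "k \<in> borel_measurable (borel \<Otimes>\<^sub>M borel)" by (simp add: borel_prod)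
  define f where "f x = (\<integral>\<^sup>+y. ennreal (k (x, y)) \<partial>lborel)" for x
  have dist_f: "distributed M lborel X f"
    using joint_density_marginal(1)[OF dens_k] unfolding f_def .
  have law: "distr M borel X = density lborel f" by (rule distr_eq_density[OF dist_f])
  have [measurable]: "f \<in> borel_measurable borel" using dist_f by (simp add: distributed_def)
  interpret D: real_distribution "distr M borel X" by simp
  note f_finite = AE_density_finite[OF dist_f]
  \<comment> \<open>Where the marginal density is 0 or infinite the quotient has no meaning as a
    conditional probability; \<open>S\<close> excludes these points and still carries the law of
    \<open>X\<close>.\<close>
  define S where "S = {x. 0 < f x \<and> f x \<noteq> \<infinity>}"
  have AE_S: "AE \<omega> in M. X \<omega> \<in> S"
  proof -
    have [measurable]: "S \<in> sets borel" unfolding S_def by measurable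
    have "AE x in density lborel f. x \<in> S"
      using f_finite by (subst AE_density) (auto simp: S_def elim: eventually_mono)
    then show ?thesis unfolding law[symmetric] by (subst (asm) AE_distr_iff) auto
  qed
  show ?thesis unfolding SI_def
  proof
    fix y :: real
    define N where "N x = (\<integral>\<^sup>+t\<in>{y<..}. ennreal (k (x, t)) \<partial>lborel)" for x
    define L where "L x = (\<integral>\<^sup>+s\<in>{..y}. ennreal (k (x, s)) \<partial>lborel)" for x
    have [measurable]: "N \<in> borel_measurable borel" unfolding N_def by measurable
    have sum: "f x = N x + L x" for x
    proof -
      have "f x = (\<integral>\<^sup>+t. ennreal (k (x, t)) * indicator {y<..} t + ennreal (k (x, t)) * indicator {..y} t \<partial>lborel)"
        unfolding f_def by (rule nn_integral_cong) (auto simp: indicator_def)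
      also have "\<dots> = N x + L x" unfolding N_def L_def by (rule nn_integral_add) auto
      finally show ?thesis .
    qed
    define p where "p x = enn2real (N x / f x)" for x
    have [measurable]: "p \<in> borel_measurable borel" unfolding p_def by measurable
    have p_ge: "0 \<le> p x" for x by (simp add: p_def)
    have p_eq: "p x = enn2real (N x) / (enn2real (N x) + enn2real (L x))" and fin: "N x < \<top>" "L x < \<top>"
      and pos: "0 < enn2real (N x) + enn2real (L x)" if "x \<in> S" for x
    proof -
      show fin: "N x < \<top>" "L x < \<top>" using that sum[of x] by (auto simp: S_def top_unique less_top)
      then have f: "f x = ennreal (enn2real (N x) + enn2real (L x))" by (simp add: sum)
      show pos: "0 < enn2real (N x) + enn2real (L x)" using that by (simp add: S_def f del: ennreal_plus)
      have "N x / f x = ennreal (enn2real (N x)) / ennreal (enn2real (N x) + enn2real (L x))" using f fin by simp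
      also have "\<dots> = ennreal (enn2real (N x) / (enn2real (N x) + enn2real (L x)))"
        by (rule divide_ennreal) (use pos in auto)
      finally show "p x = enn2real (N x) / (enn2real (N x) + enn2real (L x))"
        using pos by (simp add: p_def)
    qed
    \<comment> \<open>Outside \<open>S\<close> the quotient is 0, since in \<open>ennreal\<close>
      both 0 / 0 and division by \<infinity> give 0.\<close>
    have p_le: "p x \<le> 1" for x
    proof (cases "x \<in> S")
      case True
      then show ?thesis using pos[OF True] by (simp add: p_eq)
    next
      case False
      then have "f x = 0 \<or> f x = \<top>" by (auto simp: S_def zero_less_iff_neq_zero)
      then show ?thesis using sum[of x] by (auto simp: p_def)
    qed
    have "mono_on S p"
    proof (rule mono_onI)
      fix x1 x2 assume x: "x1 \<in> S" "x2 \<in> S" "x1 \<le> x2"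
      have "N x1 * L x2 \<le> N x2 * L x1"
        unfolding N_def L_def by (rule TP2_integrated) (use k x in auto)
      then have "enn2real (N x1) * enn2real (L x2) \<le> enn2real (N x2) * enn2real (L x1)"
        unfolding enn2real_mult[symmetric]
        by (rule enn2real_mono) (use fin x in \<open>simp add: ennreal_mult_less_top\<close>)
      then show "p x1 \<le> p x2"
        using pos[OF x(1)] pos[OF x(2)] by (simp add: p_eq x divide_le_eq le_divide_eq algebra_simps)
    qed
    then obtain q where q: "mono q" "\<And>x. x \<in> S \<Longrightarrow> q x = p x"
      using bounded_mono_on_extend[of S p 1] p_ge p_le by blast
    have "AE \<omega> in M. real_cond_exp M (vimage_algebra (space M) X borel)
        (indicator {\<omega> \<in> space M. Y \<omega> > y}) \<omega> = p (X \<omega>)"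
    proof (rule real_cond_exp_indicator_eq)
      fix B :: "real set" assume [measurable]: "B \<in> sets borel"
      have "ennreal (prob {\<omega> \<in> space M. X \<omega> \<in> B \<and> \<omega> \<in> {\<omega> \<in> space M. Y \<omega> > y}})
          = emeasure (distr M lborel (\<lambda>\<omega>. (X \<omega>, Y \<omega>))) (B \<times> {y<..})"
        using borel_Times[of B "{y<..}"]
        by (simp add: emeasure_distr emeasure_eq_measure vimage_def Int_def conj_ac distributed_measurable[OF joint])
      also have "\<dots> = emeasure (density (lborel \<Otimes>\<^sub>M lborel) (\<lambda>p. ennreal (k p))) (B \<times> {y<..})"
        using distributed_distr_eq_density[OF joint] by (simp add: lborel_prod)
      also have "\<dots> = (\<integral>\<^sup>+p. ennreal (k p) * indicator (B \<times> {y<..}) p \<partial>(lborel \<Otimes>\<^sub>M lborel))"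
        by (rule emeasure_density) auto
      also have "\<dots> = (\<integral>\<^sup>+x. \<integral>\<^sup>+t. ennreal (k (x, t)) * indicator (B \<times> {y<..}) (x, t) \<partial>lborel \<partial>lborel)"
        by (rule lborel.nn_integral_fst[symmetric]) simp
      also have "\<dots> = (\<integral>\<^sup>+x. N x * indicator B x \<partial>lborel)"
        unfolding N_def by (intro nn_integral_cong) (auto simp: indicator_def)
      also have "\<dots> = (\<integral>\<^sup>+x. f x * ennreal (indicator B x * p x) \<partial>lborel)"
      proof (rule nn_integral_cong_AE)
        show "AE x in lborel. N x * indicator B x = f x * ennreal (indicator B x * p x)"
          using f_finite
        proof eventually_elim
          case (elim x)
          show ?case
          proof (cases "f x = 0")
            case True
            then show ?thesis using sum[of x] by simp
          next
            case False
            then have x: "x \<in> S" using elim by (simp add: S_def zero_less_iff_neq_zero)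
            have "f x * ennreal (p x) = ennreal ((enn2real (N x) + enn2real (L x)) * p x)"
              using fin[OF x] p_ge by (simp add: sum ennreal_mult)
            also have "\<dots> = N x" using p_eq[OF x] pos[OF x] fin[OF x] by simp
            finally show ?thesis by (auto simp: indicator_def)
          qed
        qed
      qed
      also have "\<dots> = (\<integral>\<^sup>+x. ennreal (indicator B x * p x) \<partial>distr M borel X)"
        unfolding law by (rule nn_integral_density[symmetric]) auto
      also have "\<dots> = ennreal (LINT x|distr M borel X. indicator B x * p x)"
        by (rule nn_integral_eq_integral)
          (use p_ge p_le in \<open>auto intro!: D.integrable_const_bound[of _ 1] simp: indicator_def abs_le_iff\<close>)
      finally show "prob {\<omega> \<in> space M. X \<omega> \<in> B \<and> \<omega> \<in> {\<omega> \<in> space M. Y \<omega> > y}} =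
          (LINT x|distr M borel X. indicator B x * p x)"
        by (subst (asm) ennreal_inj) (auto intro!: integral_nonneg simp: p_ge)
    next
      show "integrable (distr M borel X) p"
        by (rule D.integrable_const_bound[of _ 1]) (use p_ge p_le in auto)
    qed auto
    then have "AE \<omega> in M. real_cond_exp M (vimage_algebra (space M) X borel)
        (indicator {\<omega> \<in> space M. Y \<omega> > y}) \<omega> = q (X \<omega>)"
      using AE_S by eventually_elim (simp add: q)
    then show "\<exists>p. cond_prob_version M {\<omega> \<in> space M. Y \<omega> > y} X p \<and> mono p"
      using q(1) borel_measurable_mono[OF q(1)] by (auto simp: cond_prob_version_def)
  qed
qed

end

section \<open>Conditional probabilities under the copula\<close>

context lipschitz_copula_pair
begin

text \<open>Integrating the joint density over \<open>A \<times> {..y}\<close> turns the factor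
  \<open>b\<close> into \<phi>(G(y)); the complement in \<open>Y\<close> accounts for the minus
  sign.\<close>

lemma prob_X_in_Y_gt:
  assumes a: "margin_density (distr M borel X) a" and [measurable]: "A \<in> sets borel"
  shows "prob {\<omega> \<in> space M. X \<omega> \<in> A \<and> Y \<omega> > y} =
    (LINT x|distr M borel X. indicator A x * (1 - G y - \<theta> * \<phi> (G y) * a x))"
proof -
  have [measurable]: "a \<in> borel_measurable borel" and bd: "\<bar>a x\<bar> \<le> 1" for x
    using a by (simp_all add: margin_density_def)
  obtain b where b: "margin_density (distr M borel Y) b" by (rule margin_densities)
  have rect: "A \<times> {..y} \<in> sets (borel \<Otimes>\<^sub>M borel :: (real \<times> real) measure)" by simp
  have "prob {\<omega> \<in> space M. X \<omega> \<in> A \<and> Y \<omega> \<le> y} =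
      measure (distr M (borel \<Otimes>\<^sub>M borel) (\<lambda>\<omega>. (X \<omega>, Y \<omega>))) (A \<times> {..y})"
    using rect by (simp add: measure_distr vimage_def Int_def conj_commute)
  also have "\<dots> = measure (distr M borel X) A * G y
      + \<theta> * ((LINT t|distr M borel X. indicator A t * a t) * \<phi> (G y))"
    unfolding joint_law[OF a b] using measure_density_rectangle[OF a b, of A "{..y}"] b
    by (simp add: margin_density_def cdf_def)
  finally have le: "prob {\<omega> \<in> space M. X \<omega> \<in> A \<and> Y \<omega> \<le> y} = measure (distr M borel X) A * G y
      + \<theta> * ((LINT t|distr M borel X. indicator A t * a t) * \<phi> (G y))" .
  have "measure (distr M borel X) A = prob ({\<omega> \<in> space M. X \<omega> \<in> A \<and> Y \<omega> \<le> y} \<union> {\<omega> \<in> space M. X \<omega> \<in> A \<and> Y \<omega> > y})"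
    by (subst measure_distr) (auto intro!: arg_cong[of _ _ prob])
  also have "\<dots> = prob {\<omega> \<in> space M. X \<omega> \<in> A \<and> Y \<omega> \<le> y} + prob {\<omega> \<in> space M. X \<omega> \<in> A \<and> Y \<omega> > y}"
    by (rule finite_measure_Union) auto
  finally have "prob {\<omega> \<in> space M. X \<omega> \<in> A \<and> Y \<omega> > y} =
      (1 - G y) * measure (distr M borel X) A - \<theta> * \<phi> (G y) * (LINT t|distr M borel X. indicator A t * a t)"
    using le by (simp add: algebra_simps)
  also have "\<dots> = (LINT x|distr M borel X. (1 - G y) * indicator A x - \<theta> * \<phi> (G y) * (indicator A x * a x))"
  proof -
    have "integrable (distr M borel X) (\<lambda>x. indicator A x * a x)"
      by (rule DX.integrable_const_bound[of _ 1]) (auto simp: bd abs_mult indicator_def)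
    moreover have "integrable (distr M borel X) (indicator A :: _ \<Rightarrow> real)"
      by (rule DX.integrable_const_bound[of _ 1]) (auto simp: indicator_def)
    ultimately show ?thesis
      by (simp add: Bochner_Integration.integral_diff)
  qed
  finally show ?thesis by (simp add: algebra_simps)
qed

text \<open>The function is 1 minus the partial derivative of the copula in its first argument at
  (F(x), G(y)), with \<open>a\<close> in the place of \<phi>'.\<close>

lemma cond_prob_version_iff:
  assumes a: "margin_density (distr M borel X) a"
  shows "cond_prob_version M {\<omega> \<in> space M. Y \<omega> > y} X p \<longleftrightarrow>
    p \<in> borel_measurable borel \<and> (AE \<omega> in M. p (X \<omega>) = 1 - G y - \<theta> * \<phi> (G y) * a (X \<omega>))"
proof -
  have [measurable]: "a \<in> borel_measurable borel" and bd: "\<bar>a x\<bar> \<le> 1" for x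
    using a by (simp_all add: margin_density_def)
  have "AE \<omega> in M. real_cond_exp M (vimage_algebra (space M) X borel) (indicator {\<omega> \<in> space M. Y \<omega> > y}) \<omega>
      = 1 - G y - \<theta> * \<phi> (G y) * a (X \<omega>)"
  proof (rule real_cond_exp_indicator_eq[where p = "\<lambda>x. 1 - G y - \<theta> * \<phi> (G y) * a x"])
    fix B :: "real set" assume "B \<in> sets borel"
    from prob_X_in_Y_gt[OF a this, of y]
    show "prob {\<omega> \<in> space M. X \<omega> \<in> B \<and> \<omega> \<in> {\<omega> \<in> space M. Y \<omega> > y}} =
        (LINT x|distr M borel X. indicator B x * (1 - G y - \<theta> * \<phi> (G y) * a x))"
      by (simp cong: conj_cong)
  next
    have "integrable (distr M borel X) a"
      by (rule DX.integrable_const_bound[of _ 1]) (auto simp: bd)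
    then show "integrable (distr M borel X) (\<lambda>x. 1 - G y - \<theta> * \<phi> (G y) * a x)" by simp
  qed auto
  then show ?thesis
    unfolding cond_prob_version_def by (auto elim: eventually_elim2)
qed

text \<open>At a \<open>y\<close> with \<phi>(G(y)) \<noteq> 0 the formula for a monotone version
  \<open>p\<close> can be solved for \<open>a\<close>: up to sign, \<open>a\<close> agrees almost
  surely with a monotone function. Its integrals, which are the values of \<phi>, do not see the
  null set. The sign decides between convex and concave.\<close>

lemma SI_imp_convex_or_concave:
  assumes SI: "SI M X Y"
  shows "concave_on {0..1} \<phi> \<or> convex_on {0..1} \<phi>"
proof (cases "\<exists>v\<in>{0..1}. \<phi> v \<noteq> 0")
  case True
  then obtain v where v: "v \<in> {0..1}" "\<phi> v \<noteq> 0" by auto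
  then obtain y where y: "G y = v" by (rule nonzero_attained)
  obtain a where a: "margin_density (distr M borel X) a" by (rule margin_densities)
  then have [measurable]: "a \<in> borel_measurable borel" and bd: "\<bar>a x\<bar> \<le> 1" for x
    by (simp_all add: margin_density_def)
  obtain p where p: "mono p" "cond_prob_version M {\<omega> \<in> space M. Y \<omega> > y} X p"
    using SI by (auto simp: SI_def)
  define c where "c = \<theta> * \<bar>\<phi> v\<bar>"
  have c: "0 < c" using v \<theta>_pos by (simp add: c_def)
  \<comment> \<open>The quotient equals \<open>- sgn (\<phi> v) * a\<close> almost surely. Elsewhere
    \<open>p\<close> is uncontrolled, so the values are clipped to [-1, 1], which keeps monotonicity
    and gives the bound at every point.\<close>
  define b where "b x = max (-1) (min 1 ((p x - (1 - v)) / c))" for x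
  have "mono b"
    unfolding b_def using p(1) c
    by (intro monoI max.mono min.mono order_refl divide_right_mono diff_right_mono) (auto simp: mono_def)
  then have [measurable]: "b \<in> borel_measurable borel" by (rule borel_measurable_mono)
  have "AE \<omega> in M. b (X \<omega>) = - sgn (\<phi> v) * a (X \<omega>)"
    using p(2)[unfolded cond_prob_version_iff[OF a] y, THEN conjunct2]
  proof eventually_elim
    case (elim \<omega>)
    have "(p (X \<omega>) - (1 - v)) / c = - sgn (\<phi> v) * a (X \<omega>)"
      using elim v \<theta>_pos by (auto simp: c_def sgn_if field_simps)
    moreover have "\<bar>- sgn (\<phi> v) * a (X \<omega>)\<bar> \<le> 1"
      using bd[of "X \<omega>"] by (simp add: abs_mult sgn_if)
    ultimately show ?case by (simp add: b_def abs_le_iff)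
  qed
  then have AE: "AE x in distr M borel X. b x = - sgn (\<phi> v) * a x"
    by (subst AE_distr_iff) auto
  have "convex_on {0..1} (\<lambda>u. - sgn (\<phi> v) * \<phi> u)"
  proof (rule DX.convex_if_mono_cdf_density[OF cont_X _ \<open>mono b\<close>])
    show "continuous_on {0..1} (\<lambda>u. - sgn (\<phi> v) * \<phi> u)"
      by (intro continuous_intros continuous_\<phi>)
    show "- sgn (\<phi> v) * \<phi> (F x) = (LINT t|distr M borel X. indicator {..x} t * b t)" for x
    proof -
      have "(LINT t|distr M borel X. indicator {..x} t * b t) =
          (LINT t|distr M borel X. - sgn (\<phi> v) * (indicator {..x} t * a t))"
        by (rule integral_cong_AE) (use AE in \<open>auto elim: eventually_mono\<close>)
      also have "\<dots> = - sgn (\<phi> v) * \<phi> (F x)" using a by (simp add: margin_density_def)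
      finally show ?thesis by simp
    qed
  qed (simp add: b_def)
  then show ?thesis using v by (auto simp: sgn_if concave_on_def split: if_splits)
next
  case False
  have "convex_on {0..1} \<phi>"
  proof (rule convex_onI)
    fix t x y :: real assume "0 < t" "t < 1" "x \<in> {0..1}" "y \<in> {0..1}"
    moreover from this have "(1 - t) *\<^sub>R x + t *\<^sub>R y \<in> {0..1}"
      by (intro convexD_alt) auto
    ultimately show "\<phi> ((1 - t) *\<^sub>R x + t *\<^sub>R y) \<le> (1 - t) * \<phi> x + t * \<phi> y"
      using False by simp
  qed simp
  then show ?thesis by simp
qed

text \<open>\<phi> vanishes at both ends, so the convex one of \<phi> and -\<phi> lies below the
  chord 0. The sign \<open>c\<close> lets both cases be treated at once.\<close>

lemma convex_or_concave_sign:
  assumes "concave_on {0..1} \<phi> \<or> convex_on {0..1} \<phi>"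
  obtains c where "c = 1 \<or> c = -1" "convex_on {0..1} (\<lambda>u. c * \<phi> u)" "\<And>u. u \<in> {0..1} \<Longrightarrow> c * \<phi> u \<le> 0"
proof -
  have "convex_on {0..1} (\<lambda>u. 1 * \<phi> u) \<or> convex_on {0..1} (\<lambda>u. -1 * \<phi> u)"
    using assms by (simp add: concave_on_def disj_commute)
  then obtain c :: real where c: "c = 1 \<or> c = -1" "convex_on {0..1} (\<lambda>u. c * \<phi> u)" by blast
  have "c * \<phi> u \<le> 0" if "u \<in> {0..1}" for u
    using convex_onD[OF c(2), of u 0 1] that by (simp add: \<phi>0 \<phi>1)
  with c show thesis by (rule that)
qed

text \<open>As \<open>c * c = 1\<close>, multiplying a monotone density for \<open>c \<phi>\<close>
  by \<open>c\<close> gives one for \<phi>. Using the same \<open>c\<close> for \<open>X\<close> and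
  \<open>Y\<close> makes both densities monotone in the same direction.\<close>

lemma convex_margin_density:
  assumes c: "c = 1 \<or> c = -1" and convex: "convex_on {0..1} (\<lambda>u. c * \<phi> u)"
  obtains a where "margin_density (distr M borel X) a" "mono (\<lambda>x. c * a x)"
proof (rule DX.convex_cdf_density[OF cont_X _ _ convex])
  fix a assume a: "mono a" "\<And>x. \<bar>a x\<bar> \<le> 1"
    "\<And>x. c * \<phi> (F x) = (LINT t|distr M borel X. indicator {..x} t * a t)"
  have cc: "c * (c * z) = z" for z using c by auto
  have "\<phi> (F x) = (LINT t|distr M borel X. indicator {..x} t * (c * a t))" for x
  proof -
    have "(LINT t|distr M borel X. indicator {..x} t * (c * a t)) = c * (LINT t|distr M borel X. indicator {..x} t * a t)"
      by (subst integral_mult_right_zero[symmetric]) (simp add: mult.left_commute)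
    then show ?thesis by (simp add: a(3)[symmetric] cc)
  qed
  then have "margin_density (distr M borel X) (\<lambda>x. c * a x)"
    using a(2) c borel_measurable_mono[OF a(1)] by (auto simp: margin_density_def)
  moreover have "mono (\<lambda>x. c * (c * a x))" unfolding cc by (rule a(1))
  ultimately show thesis by (rule that)
qed (use \<phi>0 c lip in \<open>auto simp: abs_minus_commute\<close>)

lemma convex_or_concave_imp_SI:
  assumes "concave_on {0..1} \<phi> \<or> convex_on {0..1} \<phi>"
  shows "SI M X Y"
proof -
  obtain c where c: "c = 1 \<or> c = -1" "convex_on {0..1} (\<lambda>u. c * \<phi> u)" "\<And>u. u \<in> {0..1} \<Longrightarrow> c * \<phi> u \<le> 0"
    using convex_or_concave_sign[OF assms] by blast
  obtain a where a: "margin_density (distr M borel X) a" "mono (\<lambda>x. c * a x)"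
    by (rule convex_margin_density[OF c(1,2)])
  show ?thesis unfolding SI_def
  proof
    fix y
    let ?p = "\<lambda>x. 1 - G y - \<theta> * \<phi> (G y) * a x"
    have "mono ?p"
    proof
      fix s t :: real assume "s \<le> t"
      then have "c * a s \<le> c * a t" using a(2) by (simp add: mono_def)
      moreover have "\<theta> * (c * \<phi> (G y)) \<le> 0" using c(3)[of "G y"] G01 \<theta>_pos by (simp add: mult_le_0_iff)
      \<comment> \<open>Since \<open>c * c = 1\<close>, the product of \<phi>(G(y)) and
        \<open>a\<close> is that of \<open>c * \<phi> (G y)\<close>, which is nonpositive, and
        \<open>c * a\<close>, which is nondecreasing.\<close>
      ultimately have "\<theta> * (c * \<phi> (G y)) * (c * a t) \<le> \<theta> * (c * \<phi> (G y)) * (c * a s)"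
        by (rule mult_left_mono_neg)
      then show "?p s \<le> ?p t" using c(1) by auto
    qed
    moreover have "cond_prob_version M {\<omega> \<in> space M. Y \<omega> > y} X ?p"
    proof -
      have [measurable]: "a \<in> borel_measurable borel" using a(1) by (simp add: margin_density_def)
      show ?thesis by (simp add: cond_prob_version_iff[OF a(1)])
    qed
    ultimately show "\<exists>p. cond_prob_version M {\<omega> \<in> space M. Y \<omega> > y} X p \<and> mono p" by blast
  qed
qed

lemma SI_iff: "SI M X Y \<longleftrightarrow> concave_on {0..1} \<phi> \<or> convex_on {0..1} \<phi>"
  using SI_imp_convex_or_concave convex_or_concave_imp_SI by blast

end

section \<open>From convexity to a totally positive density\<close>

lemma (in prob_space) obtain_real_density:
  fixes X :: "'a \<Rightarrow> real"
  assumes "distributed M lborel X g"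
  obtains f where "f \<in> borel_measurable borel" "\<And>x. 0 \<le> f x" "distr M borel X = density lborel (\<lambda>x. ennreal (f x))"
proof
  have [measurable]: "g \<in> borel_measurable borel" using assms by (simp add: distributed_def)
  show "(\<lambda>x. enn2real (g x)) \<in> borel_measurable borel" by measurable
  show "distr M borel X = density lborel (\<lambda>x. ennreal (enn2real (g x)))"
    unfolding distr_eq_density[OF assms]
    using AE_density_finite[OF assms] by (intro density_cong) (auto elim: eventually_mono simp: less_top)
qed simp

context lipschitz_copula_pair
begin

text \<open>The version is f(x) g(y) (1 + \<theta> a(x) b(y)) with real marginal densities
  \<open>f\<close> and \<open>g\<close>. Its 2 by 2 determinant is \<theta> times values of
  \<open>f\<close> and \<open>g\<close> times the increments of \<open>a\<close> and
  \<open>b\<close>, the terms quadratic in \<theta> cancelling; both increments carry the sign of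
  the common \<open>c\<close>.\<close>

lemma convex_or_concave_imp_TP2_density:
  assumes dens: "joint_density M X Y h" and "concave_on {0..1} \<phi> \<or> convex_on {0..1} \<phi>"
  shows "TP2_density h"
proof -
  interpret swap: lipschitz_copula_pair M Y X \<phi> \<theta> by (rule swapped)
  obtain c where c: "c = 1 \<or> c = -1" "convex_on {0..1} (\<lambda>u. c * \<phi> u)"
    using convex_or_concave_sign[OF assms(2)] by blast
  obtain a where a: "margin_density (distr M borel X) a" "mono (\<lambda>x. c * a x)"
    by (rule convex_margin_density[OF c])
  obtain b where b: "margin_density (distr M borel Y) b" "mono (\<lambda>x. c * b x)"
    by (rule swap.convex_margin_density[OF c])
  have [measurable]: "a \<in> borel_measurable borel" "b \<in> borel_measurable borel"
    using a b by (simp_all add: margin_density_def)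
  obtain f where [measurable]: "f \<in> borel_measurable borel" and f: "\<And>x. 0 \<le> f x"
      "distr M borel X = density lborel (\<lambda>x. ennreal (f x))"
    using obtain_real_density[OF joint_density_marginal(1)[OF dens]] by blast
  obtain g where [measurable]: "g \<in> borel_measurable borel" and g: "\<And>x. 0 \<le> g x"
      "distr M borel Y = density lborel (\<lambda>x. ennreal (g x))"
    using obtain_real_density[OF joint_density_marginal(2)[OF dens]] by blast
  define k where "k = (\<lambda>(x, y). f x * g y * (1 + \<theta> * a x * b y))"
  note bounds = joint_factor_bounds[OF a(1) b(1)]
  have k_meas: "k \<in> borel_measurable (borel \<Otimes>\<^sub>M borel)" unfolding k_def by measurable
  have k_nonneg: "0 \<le> k p" for p using f(1) g(1) bounds by (simp add: k_def split: prod.split)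
  have "density lborel (\<lambda>p. ennreal (h p)) = distr M (borel \<Otimes>\<^sub>M borel) (\<lambda>\<omega>. (X \<omega>, Y \<omega>))"
  proof -
    have "distr M lborel (\<lambda>\<omega>. (X \<omega>, Y \<omega>)) = density lborel (\<lambda>p. ennreal (h p))"
      using dens by (simp add: joint_density_def distributed_def)
    moreover have "distr M lborel (\<lambda>\<omega>. (X \<omega>, Y \<omega>)) = distr M (borel \<Otimes>\<^sub>M borel) (\<lambda>\<omega>. (X \<omega>, Y \<omega>))"
      by (rule distr_cong) (simp_all only: borel_prod sets_lborel)
    ultimately show ?thesis by simp
  qed
  also have "\<dots> = density (density lborel (\<lambda>x. ennreal (f x)) \<Otimes>\<^sub>M density lborel (\<lambda>x. ennreal (g x)))
      (\<lambda>(x, y). ennreal (1 + \<theta> * a x * b y))"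
    using joint_law[OF a(1) b(1)] by (simp only: f g)
  also have "density lborel (\<lambda>x. ennreal (f x)) \<Otimes>\<^sub>M density lborel (\<lambda>x. ennreal (g x)) =
      density (lborel \<Otimes>\<^sub>M lborel) (\<lambda>(x, y). ennreal (f x) * ennreal (g y))"
    by (rule pair_measure_density)
      (use DY.sigma_finite_measure_axioms lborel.sigma_finite_measure_axioms in \<open>simp_all add: g(2)\<close>)
  also have "density \<dots> (\<lambda>(x, y). ennreal (1 + \<theta> * a x * b y)) = density (lborel \<Otimes>\<^sub>M lborel) (\<lambda>p. ennreal (k p))"
    using f(1) g(1) bounds
    by (subst density_density_eq) (auto simp: k_def ennreal_mult case_prod_beta intro!: density_cong)
  finally have "density lborel (\<lambda>p. ennreal (h p)) = density lborel (\<lambda>p. ennreal (k p))"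
    by (simp only: lborel_prod)
  moreover have "(\<lambda>p. ennreal (h p)) \<in> borel_measurable lborel"
    using dens by (simp add: joint_density_def distributed_def)
  moreover have k_meas': "k \<in> borel_measurable borel" using k_meas by (simp add: borel_prod)
  ultimately have "AE p in lborel. ennreal (h p) = ennreal (k p)"
    by (subst (asm) sigma_finite_measure.density_unique_iff[OF lborel.sigma_finite_measure_axioms]) auto
  then have "AE p in lborel. k p = h p"
    using dens k_nonneg by (auto simp: joint_density_def elim: eventually_mono)
  moreover have "TP2 k"
    unfolding TP2_def
  proof (intro allI impI)
    fix x1 x2 y1 y2 :: real assume "x1 \<le> x2" "y1 \<le> y2"
    then have "0 \<le> (c * a x2 - c * a x1) * (c * b y2 - c * b y1)"
      using a(2) b(2) by (intro mult_nonneg_nonneg) (auto simp: mono_def)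
    moreover have "(c * a x2 - c * a x1) * (c * b y2 - c * b y1) = (a x2 - a x1) * (b y2 - b y1)"
      using c(1) by (auto simp: algebra_simps)
    moreover have "0 \<le> f x1 * f x2 * g y1 * g y2 * \<theta>" using f(1) g(1) \<theta>_pos by simp
    ultimately have "0 \<le> f x1 * f x2 * g y1 * g y2 * \<theta> * ((a x2 - a x1) * (b y2 - b y1))"
      by simp
    also have "\<dots> = k (x1, y1) * k (x2, y2) - k (x1, y2) * k (x2, y1)"
      by (simp add: k_def algebra_simps)
    finally show "0 \<le> k (x1, y1) * k (x2, y2) - k (x1, y2) * k (x2, y1)" .
  qed
  ultimately show ?thesis
    unfolding TP2_density_def using k_meas' k_nonneg by auto
qed

lemma TP2_density_iff: "joint_density M X Y h \<Longrightarrow> TP2_density h \<longleftrightarrow> SI M X Y"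
  using SI_if_TP2_density convex_or_concave_imp_TP2_density SI_iff by blast

end

theorem theorem3:
  fixes \<phi> :: "real \<Rightarrow> real" and \<theta> :: real
    and M :: "'a measure" and X Y :: "'a \<Rightarrow> real" and h :: "real \<times> real \<Rightarrow> real"
  assumes "\<phi> 0 = 0" and "\<phi> 1 = 0"
    and "\<forall>x\<in>{0..1}. \<forall>y\<in>{0..1}. \<bar>\<phi> x - \<phi> y\<bar> \<le> \<bar>x - y\<bar>"
    and "0 < \<theta>" and "\<theta> \<le> 1"
    and "prob_space M"
    and "X \<in> borel_measurable M" and "Y \<in> borel_measurable M"
    and "has_copula M X Y (copula_family \<phi> \<theta>)"
    and "joint_density M X Y h"
  shows
    "(cdf (distr M borel X) = cdf (distr M borel Y) \<longrightarrow> PFD M X Y)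
     \<and> (PQD M X Y \<longleftrightarrow> (\<forall>u\<in>{0..1}. \<phi> u \<ge> 0) \<or> (\<forall>u\<in>{0..1}. \<phi> u \<le> 0))
     \<and> ((LTD M X Y \<longleftrightarrow> monotone_fun_on {0<..1} (\<lambda>u. \<phi> u / u))
        \<and> (LTD M Y X \<longleftrightarrow> monotone_fun_on {0<..1} (\<lambda>u. \<phi> u / u)))
     \<and> ((RTI M X Y \<longleftrightarrow> monotone_fun_on {0..<1} (\<lambda>u. \<phi> u / (u - 1)))
        \<and> (RTI M Y X \<longleftrightarrow> monotone_fun_on {0..<1} (\<lambda>u. \<phi> u / (u - 1))))
     \<and> ((LCSD M X Y \<longleftrightarrow> LTD M X Y) \<and> (LCSD M X Y \<longleftrightarrow> LTD M Y X))
     \<and> ((RCSI M X Y \<longleftrightarrow> RTI M X Y) \<and> (RCSI M X Y \<longleftrightarrow> RTI M Y X))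
     \<and> ((SI M X Y \<longleftrightarrow> concave_on {0..1} \<phi> \<or> convex_on {0..1} \<phi>)
        \<and> (SI M Y X \<longleftrightarrow> concave_on {0..1} \<phi> \<or> convex_on {0..1} \<phi>))
     \<and> ((TP2_density h \<longleftrightarrow> SI M X Y) \<and> (TP2_density h \<longleftrightarrow> SI M Y X))"
proof -
  interpret prob_space M by fact
  note density = \<open>joint_density M X Y h\<close>
  \<comment> \<open>Marginals of a law with a density have densities themselves, hence no atoms;
    this supplies the two continuity assumptions.\<close>
  interpret XY: lipschitz_copula_pair M X Y \<phi> \<theta>
    by unfold_locales
      (use assms continuous_cdf_if_distributed[OF joint_density_marginal(1)[OF density]]
        continuous_cdf_if_distributed[OF joint_density_marginal(2)[OF density]] in auto)
  interpret YX: lipschitz_copula_pair M Y X \<phi> \<theta> by (rule XY.swapped)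
  show ?thesis
    using XY.PFD XY.PQD_iff XY.LTD_iff YX.LTD_iff XY.RTI_iff YX.RTI_iff XY.LCSD_iff XY.RCSI_iff
      XY.SI_iff YX.SI_iff XY.TP2_density_iff[OF density]
    by simp
qed

end
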